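(* Let $c_0,c_1,c_2>0$ be constants and let $R_1=O(\sqrt q)$, $R_2=O(q)$, $R_3=O(\sqrt q)$ (as $q\to0$) and $h_1$ be functions of $\sqrt q$ that are analytic around $0$, where $q=\mu s$. For $f\in\mathcal S^1_{\mu,L}$ and a stepsize $s>0$, consider the algorithm: given $x_0\in\mathbb R^n$, set $x_1=x_0-h_1s\nabla f(x_0)$ and for $k\ge1$ $$x_{k+1}=x_k-(c_0+R_1)s\nabla f(x_k)+(1-c_1\sqrt q+R_2)(x_k-x_{k-1})-\Big(c_2\sqrt{c_0}-\frac{c_0}{2}+R_3\Big)s\big(\nabla f(x_k)-\nabla f(x_{k-1})\big).$$ (i) If $c_0/4\le c_2^2<c_0$ and $c_1^2>4c_0$, then there exist constants $C_0,C_1>0$, depending only on $(c_0,c_1,c_2)$ and $(R_1,R_2,R_3)$, and a constant $C>0$ depending only on $(c_0,c_1,c_2)$, $(R_1,R_2,R_3)$ and $h_1$, such that for all $0<\mu\le L$, all $f\in\mathcal S^1_{\mu,L}$, all $x_0\in\mathbb R^n$, all $0<s\le C_0\,\mu/L^2$ and all $k\ge1$, $$f(x_k)-f^*\le C\,L\,\|x_0-x^*\|^2(1-C_1\sqrt{\mu s})^k.\qquad(1)$$ (ii) If $c_2^2\ge c_0$ and $c_1^2>4c_0$, then there exist constants $C_0,C_1>0$, depending only on $(c_0,c_1,c_2)$ and $(R_1,R_2,R_3)$, and a constant $C>0$ depending only on $(c_0,c_1,c_2)$, $(R_1,R_2,R_3)$ and $h_1$, such that (1) holds for all $0<\mu\le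 L$, all $f\in\mathcal S^1_{\mu,L}$, all $x_0\in\mathbb R^n$, all $0<s\le C_0/L$ and all $k\ge1$.
   Context: For $0<\mu\le L$, $\mathcal S^1_{\mu,L}$ is the set of continuously differentiable convex functions $f:\mathbb R^n\to\mathbb R$ that are $L$-smooth ($\|\nabla f(y)-\nabla f(x)\|\le L\|y-x\|$ for all $x,y$) and $\mu$-strongly convex ($f(y)\ge f(x)+\langle\nabla f(x),y-x\rangle+\frac{\mu}{2}\|y-x\|^2$ for all $x,y$); $\|\cdot\|$ is the Euclidean norm. $x^*$ is the unique minimizer of $f$ and $f^*=f(x^* )$. The functions $R_1,R_2,R_3,h_1$ are evaluated at $\sqrt q=\sqrt{\mu s}$; they are taken to be analytic on a fixed common neighborhood of an interval $[0,\sqrt{q_0}]$ with $q_0>0$, and $C_0$ (which may depend on $q_0$) is in particular such that $q\le q_0$. *)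

theory Defs
  imports "HOL-Analysis.Analysis" "HOL-Library.Landau_Symbols" "Jordan_Normal_Form.Matrix"
begin

text \<open>
  The constants of the theorem must not depend on the dimension \<open>n\<close>, so \<open>n\<close> is quantified
  inside the formula and \<open>\<real>\<^sup>n\<close> is \<open>carrier_vec n :: real Matrix.vec set\<close> rather than a type.
  Functions on \<open>\<real>\<^sup>n\<close> are only ever constrained and evaluated on this carrier.
\<close>

definition vnorm :: "real Matrix.vec \<Rightarrow> real" where
  "vnorm v = sqrt (scalar_prod v v)"

definition has_gradient ::
    "nat \<Rightarrow> (real Matrix.vec \<Rightarrow> real) \<Rightarrow> real Matrix.vec \<Rightarrow> real Matrix.vec \<Rightarrow> bool" where
  "has_gradient n f g x \<longleftrightarrow>
     g \<in> carrier_vec n \<and>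
     (\<forall>e>0. \<exists>d>0. \<forall>y\<in>carrier_vec n. vnorm (y - x) < d \<longrightarrow>
        \<bar>f y - f x - scalar_prod g (y - x)\<bar> \<le> e * vnorm (y - x))"

definition gradient ::
    "nat \<Rightarrow> (real Matrix.vec \<Rightarrow> real) \<Rightarrow> real Matrix.vec \<Rightarrow> real Matrix.vec" where
  "gradient n f x = (THE g. has_gradient n f g x)"

definition continuously_differentiable :: "nat \<Rightarrow> (real Matrix.vec \<Rightarrow> real) \<Rightarrow> bool" where
  "continuously_differentiable n f \<longleftrightarrow>
     (\<forall>x\<in>carrier_vec n. \<exists>g. has_gradient n f g x) \<and>
     (\<forall>x\<in>carrier_vec n. \<forall>e>0. \<exists>d>0. \<forall>y\<in>carrier_vec n.
        vnorm (y - x) < d \<longrightarrow> vnorm (gradient n f y - gradient n f x) < e)"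

definition convex_fun :: "nat \<Rightarrow> (real Matrix.vec \<Rightarrow> real) \<Rightarrow> bool" where
  "convex_fun n f \<longleftrightarrow>
     (\<forall>x\<in>carrier_vec n. \<forall>y\<in>carrier_vec n. \<forall>t\<in>{0..1}.
        f ((1 - t) \<cdot>\<^sub>v x + t \<cdot>\<^sub>v y) \<le> (1 - t) * f x + t * f y)"

definition L_smooth :: "nat \<Rightarrow> real \<Rightarrow> (real Matrix.vec \<Rightarrow> real) \<Rightarrow> bool" where
  "L_smooth n L f \<longleftrightarrow>
     (\<forall>x\<in>carrier_vec n. \<forall>y\<in>carrier_vec n.
        vnorm (gradient n f y - gradient n f x) \<le> L * vnorm (y - x))"

definition strongly_convex :: "nat \<Rightarrow> real \<Rightarrow> (real Matrix.vec \<Rightarrow> real) \<Rightarrow> bool" where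
  "strongly_convex n \<mu> f \<longleftrightarrow>
     (\<forall>x\<in>carrier_vec n. \<forall>y\<in>carrier_vec n.
        f y \<ge> f x + scalar_prod (gradient n f x) (y - x) + \<mu> / 2 * (vnorm (y - x))\<^sup>2)"

definition S1 :: "nat \<Rightarrow> real \<Rightarrow> real \<Rightarrow> (real Matrix.vec \<Rightarrow> real) set" where
  "S1 n \<mu> L =
     {f. continuously_differentiable n f \<and> convex_fun n f \<and> L_smooth n L f \<and> strongly_convex n \<mu> f}"

text \<open>
  Real analyticity at every point of \<open>S\<close>, as for \<open>analytic_on\<close>: the local expansions live on
  neighbourhoods, so this says that \<open>f\<close> is analytic on some open set containing \<open>S\<close>.
\<close>

definition real_analytic_on :: "(real \<Rightarrow> real) \<Rightarrow> real set \<Rightarrow> bool" where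
  "real_analytic_on f S \<longleftrightarrow> (\<forall>a\<in>S. \<exists>F. (\<lambda>t. f (a + t)) has_fps_expansion F)"

text \<open>
  The functions \<open>R1\<close>, \<open>R2\<close>, \<open>R3\<close> and \<open>h1\<close> take \<open>sqrt q\<close>, not \<open>q\<close>, as argument.
\<close>

fun iterates ::
    "real \<Rightarrow> real \<Rightarrow> real \<Rightarrow> (real \<Rightarrow> real) \<Rightarrow> (real \<Rightarrow> real) \<Rightarrow> (real \<Rightarrow> real) \<Rightarrow> (real \<Rightarrow> real) \<Rightarrow>
     nat \<Rightarrow> (real Matrix.vec \<Rightarrow> real) \<Rightarrow> real \<Rightarrow> real \<Rightarrow> real Matrix.vec \<Rightarrow> nat \<Rightarrow> real Matrix.vec"
where
  "iterates c0 c1 c2 R1 R2 R3 h1 n f \<mu> s x0 0 = x0"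
| "iterates c0 c1 c2 R1 R2 R3 h1 n f \<mu> s x0 (Suc 0) =
     x0 - (h1 (sqrt (\<mu> * s)) * s) \<cdot>\<^sub>v gradient n f x0"
| "iterates c0 c1 c2 R1 R2 R3 h1 n f \<mu> s x0 (Suc (Suc k)) =
     (let r = sqrt (\<mu> * s);
          x = iterates c0 c1 c2 R1 R2 R3 h1 n f \<mu> s x0 (Suc k);
          x' = iterates c0 c1 c2 R1 R2 R3 h1 n f \<mu> s x0 k
      in x - ((c0 + R1 r) * s) \<cdot>\<^sub>v gradient n f x
           + (1 - c1 * r + R2 r) \<cdot>\<^sub>v (x - x')
           - ((c2 * sqrt c0 - c0 / 2 + R3 r) * s) \<cdot>\<^sub>v (gradient n f x - gradient n f x'))"

end

theory Submission
  imports Defs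
begin

text \<open>
  Rescale to \<open>s = 1\<close>, that is, replace \<open>f\<close>, \<open>L\<close>, \<open>\<mu>\<close> by \<open>s f\<close>, \<open>s L\<close>, \<open>r\<^sup>2 = \<mu> s\<close>, and let \<open>a\<close>, \<open>\<gamma>\<close>
  and \<open>1 - \<eta> r\<close> be the coefficients of \<open>g\<^sub>k\<close>, \<open>g\<^sub>k - g\<^sub>k\<^sub>-\<^sub>1\<close> and \<open>x\<^sub>k - x\<^sub>k\<^sub>-\<^sub>1\<close>. With
  \<open>w\<^sub>k = x\<^sub>k\<^sub>+\<^sub>1 - x\<^sub>k + \<gamma> g\<^sub>k\<close> and \<open>y\<^sub>k = x\<^sub>k - x\<^sup>*\<close>, the Lyapunov function is
  \<open>a (f(x\<^sub>k) - f\<^sup>*) + (|w\<^sub>k + \<eta> r y\<^sub>k|\<^sup>2 + |w\<^sub>k|\<^sup>2) / 4 - a (a - \<gamma>) |g\<^sub>k|\<^sup>2 / 2\<close>.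
  The first square produces the dissipation \<open>- r \<langle>g, y\<rangle>\<close> and the second one \<open>- r |x\<^sub>k\<^sub>+\<^sub>1 - x\<^sub>k|\<^sup>2\<close>;
  co-coercivity of the gradient controls the gradient differences; and the last term makes the
  remaining gradient terms telescope up to \<open>a (a - 2 \<gamma>) |g\<^sub>k|\<^sup>2 / 2\<close>. To leading order
  \<open>a - 2 \<gamma> = 2 \<surd>c\<^sub>0 (\<surd>c\<^sub>0 - c\<^sub>2)\<close>, which is nonpositive if \<open>c\<^sub>2\<^sup>2 \<ge> c\<^sub>0\<close>. Otherwise
  \<open>|g|\<^sup>2 \<le> 2 L (f - f\<^sup>*)\<close> lets the dissipation absorb this term as soon as \<open>L\<close> is at most a small
  multiple of \<open>r\<close>, which in the original scaling reads \<open>s \<le> C\<^sub>0 \<mu> / L\<^sup>2\<close>.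
\<close>

section \<open>Smooth strongly convex functions on \<open>carrier_vec n\<close>\<close>

lemma scalar_prod_self_nonneg: "0 \<le> scalar_prod v (v :: real Matrix.vec)"
  by (simp add: scalar_prod_def sum_nonneg)

lemma vnorm_nonneg: "0 \<le> vnorm v"
  by (simp add: vnorm_def scalar_prod_self_nonneg)

lemma vnorm_sq: "(vnorm v)\<^sup>2 = scalar_prod v v"
  by (simp add: vnorm_def scalar_prod_self_nonneg)

lemma vnorm_smult: "vnorm (t \<cdot>\<^sub>v v) = \<bar>t\<bar> * vnorm v"
  by (simp add: vnorm_def real_sqrt_mult)

lemma scalar_prod_self_eq_0:
  assumes "(v :: real Matrix.vec) \<in> carrier_vec n" "scalar_prod v v = 0"
  shows "v = 0\<^sub>v n"
  using assms by (auto simp: scalar_prod_def sum_nonneg_eq_0_iff)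

lemma scalar_prod_Cauchy_Schwarz:
  assumes "x \<in> carrier_vec n" "y \<in> carrier_vec n"
  shows "scalar_prod x y \<le> vnorm x * vnorm y"
proof -
  have "(scalar_prod x y)\<^sup>2 \<le> scalar_prod x x * scalar_prod y y"
    using assms Cauchy_Schwarz_ineq_sum[of "vec_index x" "vec_index y" "{0..<n}"]
    by (simp add: scalar_prod_def power2_eq_square)
  then have "(scalar_prod x y)\<^sup>2 \<le> (vnorm x * vnorm y)\<^sup>2"
    by (simp add: power_mult_distrib vnorm_sq)
  then show ?thesis
    by (rule power2_le_imp_le) (simp add: vnorm_nonneg)
qed

lemmas scalar_prod_expand =
  add_scalar_prod_distrib scalar_prod_add_distrib minus_scalar_prod_distrib
  scalar_prod_minus_distrib

section \<open>Gradients and derivatives along lines\<close>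

lemma has_gradientD:
  assumes "has_gradient n f g x" "e > 0"
  shows "\<exists>d>0. \<forall>y\<in>carrier_vec n. vnorm (y - x) < d \<longrightarrow>
    \<bar>f y - f x - scalar_prod g (y - x)\<bar> \<le> e * vnorm (y - x)"
  using assms by (simp add: has_gradient_def)

text \<open>Both candidates approximate \<open>f\<close> to first order, so along their difference
  \<open>u\<close> the two linear parts differ by \<open>t * |u|\<^sup>2\<close> but also by at most
  \<open>2 * e * t * |u|\<close>. This justifies the definite description in
  \<open>gradient\<close>.\<close>

lemma has_gradient_unique:
  assumes x: "x \<in> carrier_vec n" and g1: "has_gradient n f g1 x" and g2: "has_gradient n f g2 x"
  shows "g1 = g2"
proof -
  have c: "g1 \<in> carrier_vec n" "g2 \<in> carrier_vec n"
    using g1 g2 by (auto simp: has_gradient_def)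
  define u where "u = g1 - g2"
  have u: "u \<in> carrier_vec n" using c by (simp add: u_def)
  have small: "vnorm u \<le> 2 * e" if e: "e > 0" for e
  proof (rule ccontr)
    assume neg: "\<not> vnorm u \<le> 2 * e"
    with e have pos: "vnorm u > 0" by linarith
    obtain d1 where d1: "d1 > 0" "\<And>y. y \<in> carrier_vec n \<Longrightarrow> vnorm (y - x) < d1 \<Longrightarrow>
        \<bar>f y - f x - scalar_prod g1 (y - x)\<bar> \<le> e * vnorm (y - x)"
      using has_gradientD[OF g1 e] by blast
    obtain d2 where d2: "d2 > 0" "\<And>y. y \<in> carrier_vec n \<Longrightarrow> vnorm (y - x) < d2 \<Longrightarrow>
        \<bar>f y - f x - scalar_prod g2 (y - x)\<bar> \<le> e * vnorm (y - x)"
      using has_gradientD[OF g2 e] by blast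
    \<comment> \<open>The displacement \<open>t u\<close> then has half the length of the smaller
      radius, so both approximations apply at the same point.\<close>
    define t where "t = min d1 d2 / (2 * vnorm u)"
    have t: "t > 0" using d1(1) d2(1) pos by (simp add: t_def)
    define y where "y = x + t \<cdot>\<^sub>v u"
    have y: "y \<in> carrier_vec n" using x u by (simp add: y_def)
    have yx: "y - x = t \<cdot>\<^sub>v u" using x u by (auto simp: y_def)
    have nyx: "vnorm (y - x) = t * vnorm u" using t by (simp add: yx vnorm_smult)
    have "t * vnorm u = min d1 d2 / 2" using pos by (simp add: t_def)
    then have "vnorm (y - x) < d1" "vnorm (y - x) < d2" using d1(1) d2(1) nyx by auto
    from d1(2)[OF y this(1)] d2(2)[OF y this(2)]
    have "\<bar>scalar_prod g1 (y - x) - scalar_prod g2 (y - x)\<bar> \<le> 2 * e * (t * vnorm u)"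
      unfolding nyx by linarith
    moreover have "scalar_prod g1 (y - x) - scalar_prod g2 (y - x) = t * (vnorm u)\<^sup>2"
      using c u unfolding yx vnorm_sq
      by (simp add: u_def scalar_prod_expand[where n=n] algebra_simps)
    ultimately have "t * (vnorm u)\<^sup>2 \<le> 2 * e * (t * vnorm u)" by linarith
    then have "(t * vnorm u) * vnorm u \<le> (t * vnorm u) * (2 * e)"
      by (simp add: power2_eq_square algebra_simps)
    then have "vnorm u \<le> 2 * e" using t pos by (simp add: mult_le_cancel_left)
    then show False using neg by simp
  qed
  have "vnorm u \<le> 0"
    by (rule field_le_epsilon) (use small[of "_ / 2"] in simp)
  then have "scalar_prod u u = 0"
    using vnorm_nonneg[of u] vnorm_sq[of u] by simp
  then have "u = 0\<^sub>v n" by (rule scalar_prod_self_eq_0[OF u])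
  then have "g1 - g2 = 0\<^sub>v n" by (simp only: u_def)
  show ?thesis
  proof (rule eq_vecI)
    fix i assume i: "i < dim_vec g2"
    have "vec_index (g1 - g2) i = vec_index (0\<^sub>v n) i" by (simp only: \<open>g1 - g2 = 0\<^sub>v n\<close>)
    then show "vec_index g1 i = vec_index g2 i" using c i by simp
  qed (use c in simp)
qed

lemma has_gradient_gradient:
  assumes "continuously_differentiable n f" "x \<in> carrier_vec n"
  shows "has_gradient n f (gradient n f x) x"
proof -
  obtain g where "has_gradient n f g x"
    using assms by (auto simp: continuously_differentiable_def)
  with has_gradient_unique[OF assms(2)] show ?thesis
    unfolding gradient_def by (metis theI)
qed

lemma line_has_derivative:
  assumes f: "continuously_differentiable n f" and x: "x \<in> carrier_vec n" and d: "d \<in> carrier_vec n"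
  shows "((\<lambda>t. f (x + t \<cdot>\<^sub>v d)) has_real_derivative
      scalar_prod (gradient n f (x + t \<cdot>\<^sub>v d)) d) (at t)"
  unfolding has_field_derivative_def has_derivative_at_alt
proof (intro conjI allI impI)
  define z where "z = x + t \<cdot>\<^sub>v d"
  define g where "g = gradient n f z"
  have z: "z \<in> carrier_vec n" using x d by (simp add: z_def)
  have hg: "has_gradient n f g z"
    unfolding g_def by (rule has_gradient_gradient[OF f z])
  then have g: "g \<in> carrier_vec n" by (simp add: has_gradient_def)
  fix e :: real assume e: "e > 0"
  \<comment> \<open>The added 1 keeps the divisor positive when \<open>d = 0\<close>.\<close>
  define N where "N = vnorm d + 1"
  have N: "N > 0" "vnorm d \<le> N" using vnorm_nonneg[of d] by (auto simp: N_def)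
  have eN: "e / N > 0" using e N by simp
  obtain \<delta> where \<delta>: "\<delta> > 0" "\<And>y. y \<in> carrier_vec n \<Longrightarrow> vnorm (y - z) < \<delta> \<Longrightarrow>
        \<bar>f y - f z - scalar_prod g (y - z)\<bar> \<le> e / N * vnorm (y - z)"
    using has_gradientD[OF hg eN] by blast
  show "\<exists>da>0. \<forall>u. norm (u - t) < da \<longrightarrow>
      norm (f (x + u \<cdot>\<^sub>v d) - f (x + t \<cdot>\<^sub>v d) -
        scalar_prod (gradient n f (x + t \<cdot>\<^sub>v d)) d * (u - t)) \<le> e * norm (u - t)"
  proof (intro exI[of _ "\<delta> / N"] conjI allI impI)
    show "\<delta> / N > 0" using \<delta> N by simp
    fix u assume u: "norm (u - t) < \<delta> / N"
    define y where "y = x + u \<cdot>\<^sub>v d"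
    have y: "y \<in> carrier_vec n" using x d by (simp add: y_def)
    have yz: "y - z = (u - t) \<cdot>\<^sub>v d" using x d by (auto simp: y_def z_def algebra_simps)
    have n1: "vnorm (y - z) = \<bar>u - t\<bar> * vnorm d" by (simp add: yz vnorm_smult)
    have n2: "vnorm (y - z) \<le> \<bar>u - t\<bar> * N" unfolding n1 using N by (simp add: mult_left_mono)
    have "\<bar>u - t\<bar> * N < \<delta>" using u N by (simp add: field_simps)
    then have "\<bar>f y - f z - scalar_prod g (y - z)\<bar> \<le> e / N * vnorm (y - z)"
      using \<delta>(2)[OF y] n2 by simp
    also have "\<dots> \<le> e / N * (\<bar>u - t\<bar> * N)" using n2 e N by (intro mult_left_mono) auto
    also have "\<dots> = e * \<bar>u - t\<bar>" using N by simp
    finally show "norm (f (x + u \<cdot>\<^sub>v d) - f (x + t \<cdot>\<^sub>v d) -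
        scalar_prod (gradient n f (x + t \<cdot>\<^sub>v d)) d * (u - t)) \<le> e * norm (u - t)"
      using g d by (simp add: yz y_def[symmetric] z_def[symmetric] g_def[symmetric] mult.commute)
  qed
qed (rule bounded_linear_mult_right)

section \<open>Inequalities for smooth strongly convex functions\<close>

locale S1_function =
  fixes n :: nat and \<mu> L :: real and f :: "real Matrix.vec \<Rightarrow> real"
  assumes mu_pos: "0 < \<mu>" and mu_le: "\<mu> \<le> L" and f_S1: "f \<in> S1 n \<mu> L"
begin

abbreviation grad where "grad \<equiv> gradient n f"

lemma smoothness_pos: "0 < L"
  using mu_pos mu_le by simp

lemma grad_carrier [simp]: "x \<in> carrier_vec n \<Longrightarrow> grad x \<in> carrier_vec n"
  using f_S1 has_gradient_gradient[of n f x] by (auto simp: S1_def has_gradient_def)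

lemma grad_lipschitz:
  assumes "x \<in> carrier_vec n" "y \<in> carrier_vec n"
  shows "vnorm (grad y - grad x) \<le> L * vnorm (y - x)"
  using assms f_S1 by (auto simp: S1_def L_smooth_def)

lemma strong_lower_bound:
  assumes "x \<in> carrier_vec n" "y \<in> carrier_vec n"
  shows "f x + scalar_prod (grad x) (y - x) + \<mu> / 2 * scalar_prod (y - x) (y - x) \<le> f y"
  using assms f_S1 by (auto simp: S1_def strongly_convex_def vnorm_sq)

text \<open>Along the segment, \<open>h\<close> is \<open>f\<close> minus its linear part and the
  quadratic \<open>L / 2 * t\<^sup>2 * |d|\<^sup>2\<close>. Its derivative is nonpositive by
  Cauchy-Schwarz and the Lipschitz bound on the gradient.\<close>

lemma descent:
  assumes x: "x \<in> carrier_vec n" and y: "y \<in> carrier_vec n"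
  shows "f y \<le> f x + scalar_prod (grad x) (y - x) + L / 2 * scalar_prod (y - x) (y - x)"
proof -
  define d where "d = y - x"
  have d: "d \<in> carrier_vec n" using x y by (simp add: d_def)
  have yd: "x + 1 \<cdot>\<^sub>v d = y" "x + 0 \<cdot>\<^sub>v d = x" using x y by (auto simp: d_def)
  define h where "h t = f (x + t \<cdot>\<^sub>v d) - t * scalar_prod (grad x) d - L / 2 * t\<^sup>2 * scalar_prod d d" for t
  have cd: "continuously_differentiable n f" using f_S1 by (simp add: S1_def)
  have "h 1 \<le> h 0"
  proof (rule DERIV_nonpos_imp_nonincreasing[where f = h])
    fix t :: real assume t: "0 \<le> t" "t \<le> 1"
    define z where "z = x + t \<cdot>\<^sub>v d"
    have z: "z \<in> carrier_vec n" using x d by (simp add: z_def)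
    have zx: "z - x = t \<cdot>\<^sub>v d" using x d by (auto simp: z_def)
    have "(h has_real_derivative
        scalar_prod (grad z) d - scalar_prod (grad x) d - L * t * scalar_prod d d) (at t)"
      unfolding h_def z_def
      by (rule derivative_eq_intros line_has_derivative[OF cd x d] refl | simp)+
    moreover have "scalar_prod (grad z - grad x) d \<le> vnorm (grad z - grad x) * vnorm d"
      using x z d by (intro scalar_prod_Cauchy_Schwarz[of _ n]) auto
    moreover have "\<dots> \<le> (L * (t * vnorm d)) * vnorm d"
      using grad_lipschitz[OF x z] t vnorm_nonneg[of d]
      by (intro mult_right_mono) (auto simp: zx vnorm_smult)
    moreover have "\<dots> = L * t * scalar_prod d d"
      by (simp add: vnorm_sq[symmetric] power2_eq_square)
    moreover have "scalar_prod (grad z - grad x) d = scalar_prod (grad z) d - scalar_prod (grad x) d"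
      using x z d by (simp add: scalar_prod_expand[where n=n])
    ultimately show "\<exists>D. (h has_real_derivative D) (at t) \<and> D \<le> 0" by force
  qed simp
  then show ?thesis
    unfolding h_def yd by (simp add: d_def[symmetric])
qed

text \<open>Both bounds are evaluated at \<open>z\<close>, the minimizer of the quadratic upper
  model at \<open>y\<close> of \<open>f\<close> minus the linear function with slope
  \<open>gx\<close>. Convexity at \<open>x\<close> bounds \<open>f z\<close> from below and
  \<open>descent\<close> from \<open>y\<close> bounds it from above.\<close>

lemma cocoercive:
  assumes x: "x \<in> carrier_vec n" and y: "y \<in> carrier_vec n"
  shows "f x - f y \<le> scalar_prod (grad x) (x - y)
    - 1 / (2 * L) * scalar_prod (grad x - grad y) (grad x - grad y)"
proof -
  define gx where "gx = grad x"
  define gy where "gy = grad y"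
  define z where "z = y - (1 / L) \<cdot>\<^sub>v (gy - gx)"
  have c: "gx \<in> carrier_vec n" "gy \<in> carrier_vec n" "z \<in> carrier_vec n"
    using x y by (auto simp: gx_def gy_def z_def)
  have "0 \<le> \<mu> / 2 * scalar_prod (z - x) (z - x)"
    using mu_pos by (simp add: scalar_prod_self_nonneg)
  with strong_lower_bound[OF x c(3)] have 1: "f x + scalar_prod gx (z - x) \<le> f z"
    by (simp add: gx_def)
  have zy: "z - y = (1 / L) \<cdot>\<^sub>v (gx - gy)"
    using x y c by (auto simp: z_def algebra_simps)
  have 2: "f z \<le> f y + 1 / L * scalar_prod gy (gx - gy)
      + L / 2 * (1 / L * (1 / L * scalar_prod (gx - gy) (gx - gy)))"
    using descent[OF y c(3)] c by (simp add: zy gy_def[symmetric])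
  have 3: "scalar_prod gx (z - x) = scalar_prod gx (y - x) + 1 / L * scalar_prod gx (gx - gy)"
    using x y c by (simp add: z_def scalar_prod_expand[where n=n] algebra_simps)
  have 4: "scalar_prod gx (gx - gy) - scalar_prod gy (gx - gy) = scalar_prod (gx - gy) (gx - gy)"
    using c by (simp add: scalar_prod_expand[where n=n])
  have 5: "scalar_prod gx (x - y) = - scalar_prod gx (y - x)"
    using x y c by (simp add: scalar_prod_expand[where n=n])
  have 6: "L / 2 * (1 / L * (1 / L * scalar_prod (gx - gy) (gx - gy)))
      = 1 / L * scalar_prod (gx - gy) (gx - gy) - 1 / (2 * L) * scalar_prod (gx - gy) (gx - gy)"
    using smoothness_pos by (simp add: field_simps)
  have "1 / L * scalar_prod gx (gx - gy) - 1 / L * scalar_prod gy (gx - gy)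
      = 1 / L * scalar_prod (gx - gy) (gx - gy)"
    unfolding 4[symmetric] by (simp add: algebra_simps)
  with 1 2 3 5 6 have "f x - f y \<le> scalar_prod gx (x - y) - 1 / (2 * L) * scalar_prod (gx - gy) (gx - gy)"
    by linarith
  then show ?thesis by (simp add: gx_def gy_def)
qed

context
  fixes xstar
  assumes min: "is_arg_min f (\<lambda>x. x \<in> carrier_vec n) xstar"
begin

lemma minimizer_carrier: "xstar \<in> carrier_vec n"
  using min by (simp add: is_arg_min_def)

lemma minimizer_le: "x \<in> carrier_vec n \<Longrightarrow> f xstar \<le> f x"
  using min by (auto simp: is_arg_min_def not_less)

text \<open>Otherwise a gradient step of length \<open>1 / L\<close> from \<open>xstar\<close> would
  lower \<open>f\<close> by at least \<open>|g|\<^sup>2 / (2 * L)\<close>.\<close>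

lemma minimizer_grad: "grad xstar = 0\<^sub>v n"
proof -
  define g where "g = grad xstar"
  define z where "z = xstar - (1 / L) \<cdot>\<^sub>v g"
  have c: "xstar \<in> carrier_vec n" "g \<in> carrier_vec n" "z \<in> carrier_vec n"
    using minimizer_carrier by (auto simp: g_def z_def)
  have zx: "z - xstar = (- 1 / L) \<cdot>\<^sub>v g" using c by (auto simp: z_def)
  have "f xstar \<le> f z" by (rule minimizer_le[OF c(3)])
  also have "\<dots> \<le> f xstar - 1 / (2 * L) * scalar_prod g g"
    using descent[OF c(1) c(3)] c smoothness_pos
    by (simp add: zx g_def[symmetric] field_simps power2_eq_square)
  finally have "scalar_prod g g \<le> 0" using smoothness_pos by (simp add: divide_le_0_iff)
  then have "scalar_prod g g = 0" using scalar_prod_self_nonneg[of g] by simp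
  then show ?thesis using scalar_prod_self_eq_0[OF c(2)] by (simp add: g_def)
qed

text \<open>This is \<open>cocoercive\<close> based at the minimizer, where the gradient
  vanishes.\<close>

lemma grad_sq_le:
  assumes x: "x \<in> carrier_vec n"
  shows "scalar_prod (grad x) (grad x) \<le> 2 * L * (f x - f xstar)"
proof -
  have "f xstar - f x \<le> - (1 / (2 * L) * scalar_prod (grad x) (grad x))"
    using cocoercive[OF minimizer_carrier x] minimizer_carrier x
    by (simp add: minimizer_grad scalar_prod_expand[where n = n])
  then show ?thesis using smoothness_pos by (simp add: field_simps)
qed

lemma grad_minimizer_ge:
  assumes x: "x \<in> carrier_vec n"
  shows "f x - f xstar + \<mu> / 2 * scalar_prod (x - xstar) (x - xstar)
    \<le> scalar_prod (grad x) (x - xstar)"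
  using strong_lower_bound[OF x minimizer_carrier] x minimizer_carrier
  by (simp add: scalar_prod_expand[where n = n] algebra_simps)

lemma gap_le:
  assumes x: "x \<in> carrier_vec n"
  shows "f x - f xstar \<le> L / 2 * scalar_prod (x - xstar) (x - xstar)"
  using descent[OF minimizer_carrier x] minimizer_carrier x by (simp add: minimizer_grad)

end

end

section \<open>The discrete energy\<close>

lemma scalar_prod_self_add_le:
  assumes "x \<in> carrier_vec n" "(y :: real Matrix.vec) \<in> carrier_vec n"
  shows "scalar_prod (x + y) (x + y) \<le> 2 * scalar_prod x x + 2 * scalar_prod y y"
proof -
  have "scalar_prod (x + y) (x + y) + scalar_prod (x - y) (x - y) = 2 * scalar_prod x x + 2 * scalar_prod y y"
    using assms by (simp add: scalar_prod_expand[where n=n] algebra_simps)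
  then show ?thesis using scalar_prod_self_nonneg[of "x - y"] by linarith
qed

lemma scalar_prod_self_diff_le:
  assumes "x \<in> carrier_vec n" "(y :: real Matrix.vec) \<in> carrier_vec n"
  shows "scalar_prod (x - y) (x - y) \<le> 2 * scalar_prod x x + 2 * scalar_prod y y"
proof -
  have "scalar_prod (x + y) (x + y) + scalar_prod (x - y) (x - y) = 2 * scalar_prod x x + 2 * scalar_prod y y"
    using assms by (simp add: scalar_prod_expand[where n=n] algebra_simps)
  then show ?thesis using scalar_prod_self_nonneg[of "x + y"] by linarith
qed

text \<open>Expand the square of \<open>8 t x - y\<close>. The weight 1/16 on \<open>y\<close> is
  small against the velocity dissipation, whose coefficient in \<open>dissipation\<close> is
  1/4.\<close>

lemma scalar_prod_Young:
  assumes x: "x \<in> carrier_vec n" and y: "(y :: real Matrix.vec) \<in> carrier_vec n"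
  shows "t * scalar_prod x y \<le> scalar_prod y y / 16 + 4 * t\<^sup>2 * scalar_prod x x"
proof -
  have "scalar_prod ((8 * t) \<cdot>\<^sub>v x - y) ((8 * t) \<cdot>\<^sub>v x - y)
      = 64 * t\<^sup>2 * scalar_prod x x - 16 * (t * scalar_prod x y) + scalar_prod y y"
    using assms by (simp add: scalar_prod_expand[where n=n] comm_scalar_prod[OF y x] power2_eq_square algebra_simps)
  then show ?thesis
    using scalar_prod_self_nonneg[of "(8 * t) \<cdot>\<^sub>v x - y"] by linarith
qed

text \<open>The gap \<open>F\<close>, momentum \<open>w\<close>, displacement \<open>y\<close> and
  gradient \<open>g\<close> are independent arguments, so that the algebra can be done without
  reference to \<open>f\<close>. The argument \<open>h\<close> stands for
  \<open>\<eta> * r\<close>.\<close>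

definition energy ::
    "real \<Rightarrow> real \<Rightarrow> real \<Rightarrow> real \<Rightarrow> real Matrix.vec \<Rightarrow> real Matrix.vec \<Rightarrow> real Matrix.vec \<Rightarrow> real" where
  "energy a \<gamma> h F w y g = a * F
     + (scalar_prod (w + h \<cdot>\<^sub>v y) (w + h \<cdot>\<^sub>v y) + scalar_prod w w) / 4
     - a * (a - \<gamma>) / 2 * scalar_prod g g"

text \<open>An exact identity for one step. The last term of the energy turns the \<open>g'\<close>
  contributions into a multiple of \<open>|g' - g|\<^sup>2\<close>, which leaves
  \<open>a * (a - 2 * \<gamma>) / 2 * |g|\<^sup>2\<close>.\<close>

lemma energy_difference:
  assumes v: "v \<in> carrier_vec n" and g: "g \<in> carrier_vec n" and g': "g' \<in> carrier_vec n"
    and y: "y \<in> carrier_vec n"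
  shows "energy a \<gamma> h F' (v + \<gamma> \<cdot>\<^sub>v g - h \<cdot>\<^sub>v v - a \<cdot>\<^sub>v g') (y + v) g'
      - energy a \<gamma> h F (v + \<gamma> \<cdot>\<^sub>v g) y g
    = a * (F' - F) - a * scalar_prod g' v + a * \<gamma> / 2 * scalar_prod (g' - g) (g' - g)
      + a * (a - 2 * \<gamma>) / 2 * scalar_prod g g - a * h / 2 * scalar_prod g' (y + v)
      - (h / 2 - h\<^sup>2 / 4) * scalar_prod v v + a * h * scalar_prod g' v
      - h * \<gamma> / 2 * scalar_prod g v"
proof -
  let ?w = "v + \<gamma> \<cdot>\<^sub>v g"
  note comm = comm_scalar_prod[OF v y] comm_scalar_prod[OF v g] comm_scalar_prod[OF v g']
    comm_scalar_prod[OF g y] comm_scalar_prod[OF g' y] comm_scalar_prod[OF g' g]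
  note expand = scalar_prod_expand[where n = n]
  have w: "?w \<in> carrier_vec n" using v g by simp
  have 1: "scalar_prod (?w - h \<cdot>\<^sub>v v - a \<cdot>\<^sub>v g') (?w - h \<cdot>\<^sub>v v - a \<cdot>\<^sub>v g')
      = scalar_prod ?w ?w - 2 * h * scalar_prod v ?w - 2 * a * scalar_prod g' ?w
        + h\<^sup>2 * scalar_prod v v + 2 * a * h * scalar_prod g' v + a\<^sup>2 * scalar_prod g' g'"
    using v g' w by (simp add: expand comm_scalar_prod[OF w v] comm_scalar_prod[OF w g']
      comm_scalar_prod[OF v g'] power2_eq_square algebra_simps)
  \<comment> \<open>Moving \<open>y\<close> by \<open>v\<close> cancels the damping of
    \<open>w\<close>, so the first square changes only through \<open>a g'\<close>.\<close>
  have 2: "?w - h \<cdot>\<^sub>v v - a \<cdot>\<^sub>v g' + h \<cdot>\<^sub>v (y + v) = (?w + h \<cdot>\<^sub>v y) - a \<cdot>\<^sub>v g'"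
    using v g g' y by (auto simp: algebra_simps)
  have u: "?w + h \<cdot>\<^sub>v y \<in> carrier_vec n" using w y by simp
  have 3: "scalar_prod (?w + h \<cdot>\<^sub>v y - a \<cdot>\<^sub>v g') (?w + h \<cdot>\<^sub>v y - a \<cdot>\<^sub>v g')
      = scalar_prod (?w + h \<cdot>\<^sub>v y) (?w + h \<cdot>\<^sub>v y) - 2 * a * scalar_prod g' ?w
        - 2 * a * h * scalar_prod g' y + a\<^sup>2 * scalar_prod g' g'"
  proof -
    have "scalar_prod (?w + h \<cdot>\<^sub>v y - a \<cdot>\<^sub>v g') (?w + h \<cdot>\<^sub>v y - a \<cdot>\<^sub>v g')
      = scalar_prod (?w + h \<cdot>\<^sub>v y) (?w + h \<cdot>\<^sub>v y) - 2 * a * scalar_prod g' (?w + h \<cdot>\<^sub>v y)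
        + a\<^sup>2 * scalar_prod g' g'"
      using minus_scalar_prod_distrib[of "?w + h \<cdot>\<^sub>v y" n "a \<cdot>\<^sub>v g'" "?w + h \<cdot>\<^sub>v y - a \<cdot>\<^sub>v g'"]
        scalar_prod_minus_distrib[of "?w + h \<cdot>\<^sub>v y" n "?w + h \<cdot>\<^sub>v y" "a \<cdot>\<^sub>v g'"]
        scalar_prod_minus_distrib[of "g'" n "?w + h \<cdot>\<^sub>v y" "a \<cdot>\<^sub>v g'"]
        u g' comm_scalar_prod[OF u g'] w y
      by (simp add: power2_eq_square algebra_simps)
    moreover have "scalar_prod g' (?w + h \<cdot>\<^sub>v y) = scalar_prod g' ?w + h * scalar_prod g' y"
      using g' w y scalar_prod_add_distrib[of g' n ?w "h \<cdot>\<^sub>v y"] by simp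
    ultimately show ?thesis by (simp add: algebra_simps)
  qed
  have 4: "scalar_prod v ?w = scalar_prod v v + \<gamma> * scalar_prod g v"
    "scalar_prod g' ?w = scalar_prod g' v + \<gamma> * scalar_prod g g'"
    "scalar_prod g' (y + v) = scalar_prod g' y + scalar_prod g' v"
    "scalar_prod (g' - g) (g' - g) = scalar_prod g' g' - 2 * scalar_prod g g' + scalar_prod g g"
    using v g g' y by (simp_all add: expand comm)
  show ?thesis
    unfolding energy_def 2 1 3 unfolding 4 by (simp add: field_simps power2_eq_square)
qed

text \<open>The factor 3/4 comes from splitting the mixed square with weight 2 and adding the second
  square. The bound serves both the contraction and the initial energy.\<close>

lemma energy_le:
  assumes w: "w \<in> carrier_vec n" and y: "y \<in> carrier_vec n" and a: "0 \<le> a"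
  shows "energy a \<gamma> h F w y g \<le> a * F + 3 / 4 * scalar_prod w w + h\<^sup>2 / 2 * scalar_prod y y
    + a * \<bar>a - \<gamma>\<bar> / 2 * scalar_prod g g"
proof -
  have "scalar_prod (w + h \<cdot>\<^sub>v y) (w + h \<cdot>\<^sub>v y) \<le> 2 * scalar_prod w w + 2 * (h\<^sup>2 * scalar_prod y y)"
    using scalar_prod_self_add_le[OF w smult_carrier_vec[THEN iffD2, OF y], of h] w y
    by (simp add: power2_eq_square algebra_simps)
  moreover have "- (a * (a - \<gamma>) / 2 * scalar_prod g g) \<le> a * \<bar>a - \<gamma>\<bar> / 2 * scalar_prod g g"
  proof -
    have "a * (- (a - \<gamma>)) / 2 * scalar_prod g g \<le> a * \<bar>a - \<gamma>\<bar> / 2 * scalar_prod g g"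
      using a by (intro mult_right_mono divide_right_mono mult_left_mono)
        (auto simp: scalar_prod_self_nonneg)
    then show ?thesis by (simp only: mult_minus_right divide_minus_left mult_minus_left)
  qed
  ultimately show ?thesis unfolding energy_def by (simp add: field_simps)
qed

section \<open>Contraction of the energy in one step\<close>

definition decay_rate :: "real \<Rightarrow> real \<Rightarrow> real" where
  "decay_rate c0 c1 = min (c0 * c1 / 16) (c1 / 16)"

text \<open>With \<open>S = F + r\<^sup>2 * Y + V\<close>, a step lowers the energy by at least
  \<open>decay_rate * r * S\<close>, and the new energy is at most \<open>energy_growth * S\<close>;
  the quotient governs the contraction. The summands collect the bounds \<open>b1\<close> to
  \<open>b4\<close> in \<open>energy_contraction\<close>.\<close>

definition energy_growth :: "real \<Rightarrow> real \<Rightarrow> real \<Rightarrow> real" where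
  "energy_growth c0 c1 B =
     2 * c0 + 2 + 18 * B\<^sup>2 + 24 * c0\<^sup>2 + 2 * c1\<^sup>2 + 2 * c0 * (2 * c0 + B)"

lemma decay_rate_pos: "0 < c0 \<Longrightarrow> 0 < c1 \<Longrightarrow> 0 < decay_rate c0 c1"
  by (simp add: decay_rate_def)

text \<open>Keeps the contraction factor nonnegative: \<open>c1 / 16\<close> is at most
  \<open>(c1\<^sup>2 + 1) / 32\<close>, which the summands 2 and \<open>2 * c1\<^sup>2\<close>
  dominate.\<close>

lemma decay_rate_le_energy_growth:
  assumes "0 < c0" "0 < c1" "0 \<le> B"
  shows "decay_rate c0 c1 \<le> energy_growth c0 c1 B"
proof -
  have "0 \<le> (c1 - 1)\<^sup>2" by simp
  then have "2 * c1 \<le> c1\<^sup>2 + 1" by (simp add: power2_eq_square algebra_simps)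
  moreover have "decay_rate c0 c1 \<le> c1 / 16" by (simp add: decay_rate_def)
  moreover have "0 \<le> 18 * B\<^sup>2" "0 \<le> 24 * c0\<^sup>2" "0 \<le> 2 * c0 * (2 * c0 + B)"
    using assms by auto
  ultimately show ?thesis using assms unfolding energy_growth_def by linarith
qed

text \<open>The coefficients only need to be comparable to their leading-order values, so the
  functions \<open>R1\<close>, \<open>R2\<close>, \<open>R3\<close> do not appear. \<open>L\<close>
  plays the role of the rescaled smoothness constant \<open>s L\<close>; its smallness lets
  co-coercivity absorb the gradient differences. The two parts of the theorem reach
  \<open>balance\<close> in different ways.\<close>

locale damped_regime =
  fixes c0 c1 B a \<gamma> \<eta> r L :: real
  assumes c0: "0 < c0" and c1: "0 < c1"
    and a_ge: "c0 / 2 \<le> a" and a_le: "a \<le> 2 * c0"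
    and eta_ge: "c1 / 2 \<le> \<eta>" and eta_le: "\<eta> \<le> 2 * c1"
    and gam: "\<bar>\<gamma>\<bar> \<le> B"
    and r_pos: "0 < r" and r_le: "r \<le> 1" and r_c1: "2 * c1 * r \<le> 1"
    and L_pos: "0 < L" and L_le: "L \<le> 1" and L_c0: "256 * c0 * L \<le> 1"
    and L_B: "128 * B\<^sup>2 * L \<le> c0" and L_D: "(5 * B + 4 * c0 + 8 * B\<^sup>2 / c0) * L \<le> 1"
    and balance: "L * (a - 2 * \<gamma>) \<le> c1 / 64 * r"
begin

lemma pos: "0 < a" "0 < \<eta>" "0 \<le> B"
  using c0 c1 a_ge eta_ge gam by auto

lemma eta_r: "0 < \<eta> * r" "\<eta> * r \<le> 1"
proof -
  have "\<eta> * r \<le> 2 * c1 * r" using eta_le r_pos by simp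
  then show "\<eta> * r \<le> 1" using r_c1 by simp
qed (use pos r_pos in simp)

lemma gam_sq: "\<gamma>\<^sup>2 \<le> B\<^sup>2"
  using gam pos by (metis abs_of_nonneg abs_le_square_iff)

lemma a_gam: "\<bar>a - \<gamma>\<bar> \<le> 2 * c0 + B" 
  using a_le gam pos by linarith

abbreviation "rate \<equiv> decay_rate c0 c1"
abbreviation "growth \<equiv> energy_growth c0 c1 B"

text \<open>Inner products and squared norms enter as plain reals. With
  \<open>e = \<eta> * r\<close>, the gains are \<open>p / 2 + u / 4\<close> from strong convexity,
  \<open>q / 4\<close> from damping and \<open>z / (2 * L)\<close> from co-coercivity. The errors
  cost at most \<open>3 * p / 16\<close>, \<open>q / 8\<close> and the multiple of \<open>z\<close>
  treated in \<open>t8\<close>; the rest covers \<open>t9\<close>.\<close>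

lemma dissipation:
  assumes nn: "0 \<le> F" "0 \<le> D" "0 \<le> N" "0 \<le> N'" "0 \<le> V" "0 \<le> Y"
    and dF: "dF \<le> gv - D / (2 * L)" and N: "N \<le> 2 * L * F" and gy: "F + r\<^sup>2 / 2 * Y \<le> gy"
    and N': "N' \<le> 2 * N + 2 * D"
    and young: "a * gv \<le> V / 16 + 4 * a\<^sup>2 * N"
    and young': "- (\<gamma> / 2) * gv' \<le> V / 16 + \<gamma>\<^sup>2 * N'"
  shows "a * dF - a * gv + a * \<gamma> / 2 * D + a * (a - 2 * \<gamma>) / 2 * N' - a * (\<eta> * r) / 2 * gy
      - (\<eta> * r / 2 - (\<eta> * r)\<^sup>2 / 4) * V + a * (\<eta> * r) * gv - \<eta> * r * \<gamma> / 2 * gv'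
    \<le> - (rate * r * (F + r\<^sup>2 * Y + V))"
proof -
  define e where "e = \<eta> * r"
  have e: "0 < e" "e \<le> 1" using eta_r by (auto simp: e_def)
  define p where "p = a * e * F"
  define q where "q = e * V"
  define z where "z = a * D"
  define u where "u = a * e * (r\<^sup>2 * Y)"
  have nnp: "0 \<le> p" "0 \<le> q" "0 \<le> z" "0 \<le> u"
    using nn pos e by (auto simp: p_def q_def z_def u_def)
  have t1: "a * dF - a * gv \<le> - z / (2 * L)"
    using mult_left_mono[OF dF, of a] pos by (simp add: z_def algebra_simps)
  have N'F: "N' \<le> 4 * L * F + 2 * D" using N N' by linarith
  \<comment> \<open>If \<open>a - 2 * \<gamma>\<close> is positive, the gradient is traded for
    \<open>L F\<close> and \<open>D\<close>; \<open>balance\<close> then turns the factor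
    \<open>L * (a - 2 * \<gamma>)\<close> into a small multiple of \<open>r\<close>.\<close>
  have t2: "a * (a - 2 * \<gamma>) / 2 * N' \<le> p / 16 + (2 * c0 + 2 * B) * z"
  proof (cases "a - 2 * \<gamma> \<le> 0")
    case True
    then have "a * (a - 2 * \<gamma>) / 2 * N' \<le> 0"
      using pos nn by (simp add: mult_nonneg_nonpos mult_nonpos_nonneg)
    also have "0 \<le> p / 16 + (2 * c0 + 2 * B) * z" using nnp pos c0 by simp
    finally show ?thesis .
  next
    case False
    have "a * (a - 2 * \<gamma>) / 2 * N' \<le> a * (a - 2 * \<gamma>) / 2 * (4 * L * F + 2 * D)"
      using N'F pos False by (intro mult_left_mono) auto
    also have "\<dots> = 2 * a * F * (L * (a - 2 * \<gamma>)) + (a - 2 * \<gamma>) * z"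
      by (simp add: z_def field_simps)
    also have "\<dots> \<le> 2 * a * F * (\<eta> / 32 * r) + (2 * c0 + 2 * B) * z"
    proof (intro add_mono mult_left_mono mult_right_mono)
      have "c1 / 64 * r \<le> \<eta> / 32 * r" using eta_ge r_pos by simp
      then show "L * (a - 2 * \<gamma>) \<le> \<eta> / 32 * r" using balance by linarith
    qed (use pos nn nnp a_le gam in auto)
    also have "\<dots> = p / 16 + (2 * c0 + 2 * B) * z" by (simp add: p_def e_def)
    finally show ?thesis .
  qed
  have t3: "p / 2 + u / 4 \<le> a * e / 2 * gy"
    using mult_left_mono[OF gy, of "a * e / 2"] pos e by (simp add: p_def u_def algebra_simps)
  have t4: "q / 4 \<le> (e / 2 - e\<^sup>2 / 4) * V"
  proof -
    have "e\<^sup>2 \<le> e" using e by (simp add: power2_eq_square mult_left_le)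
    then have "e / 4 * V \<le> (e / 2 - e\<^sup>2 / 4) * V" using nn by (intro mult_right_mono) auto
    then show ?thesis by (simp add: q_def)
  qed
  have aL: "a * L \<le> 1 / 128"
  proof -
    have "a * L \<le> 2 * c0 * L" using a_le L_pos by simp
    then show ?thesis using L_c0 by linarith
  qed
  have t5: "a * e * gv \<le> q / 16 + p / 16"
  proof -
    have "4 * a\<^sup>2 * N \<le> 4 * a\<^sup>2 * (2 * L * F)" using N by (intro mult_left_mono) auto
    also have "\<dots> = 8 * (a * F) * (a * L)" by (simp add: power2_eq_square)
    also have "\<dots> \<le> 8 * (a * F) * (1 / 128)" using aL pos nn by (intro mult_left_mono) auto
    finally have "a * gv \<le> V / 16 + a * F / 16" using young by linarith
    from mult_left_mono[OF this, of e] e show ?thesis by (simp add: q_def p_def algebra_simps)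
  qed
  have t6: "- (e * \<gamma> / 2 * gv') \<le> q / 16 + p / 16 + 4 * B\<^sup>2 / c0 * z"
  proof -
    have "\<gamma>\<^sup>2 * N' \<le> B\<^sup>2 * (4 * L * F + 2 * D)"
      using gam_sq N'F nn by (intro mult_mono) auto
    also have "\<dots> = 4 * (B\<^sup>2 * L) * F + 2 * B\<^sup>2 * D" by (simp add: algebra_simps)
    also have "\<dots> \<le> a / 16 * F + 2 * B\<^sup>2 * D"
      using L_B a_ge nn by (intro add_mono mult_right_mono) auto
    finally have "- (\<gamma> / 2) * gv' \<le> V / 16 + a / 16 * F + 2 * B\<^sup>2 * D" using young' by linarith
    from mult_left_mono[OF this, of e] e
    have 1: "- (e * \<gamma> / 2 * gv') \<le> q / 16 + p / 16 + e * (2 * B\<^sup>2 * D)"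
      by (simp add: q_def p_def algebra_simps)
    have "e * (2 * B\<^sup>2 * D) \<le> 1 * (2 * B\<^sup>2 * D)" using e nn by (intro mult_right_mono) auto
    also have "\<dots> = 4 * B\<^sup>2 / c0 * (c0 / 2 * D)" using c0 by simp
    also have "\<dots> \<le> 4 * B\<^sup>2 / c0 * z" unfolding z_def
      using a_ge nn c0 by (intro mult_left_mono mult_right_mono) auto
    finally show ?thesis using 1 by linarith
  qed
  have t7: "a * \<gamma> / 2 * D \<le> B / 2 * z"
  proof -
    have "\<gamma> * z \<le> B * z" using gam nnp by (intro mult_right_mono) auto
    then show ?thesis by (simp add: z_def mult_ac)
  qed
  \<comment> \<open>The coefficient on the left is the sum of those of \<open>z\<close> in
    \<open>t7\<close>, \<open>t2\<close> and \<open>t6\<close>; \<open>L_D\<close> is exactly this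
    bound.\<close>
  have t8: "(B / 2 + (2 * c0 + 2 * B) + 4 * B\<^sup>2 / c0) * z \<le> z / (2 * L)"
  proof -
    have "2 * (B / 2 + (2 * c0 + 2 * B) + 4 * B\<^sup>2 / c0) * L \<le> 1"
      using L_D by (simp add: algebra_simps)
    then have "B / 2 + (2 * c0 + 2 * B) + 4 * B\<^sup>2 / c0 \<le> 1 / (2 * L)"
      using L_pos by (simp add: pos_le_divide_eq algebra_simps)
    from mult_right_mono[OF this nnp(3)] show ?thesis by simp
  qed
  have t9: "rate * r * (F + r\<^sup>2 * Y + V) \<le> p / 4 + u / 4 + q / 8"
  proof -
    have "c0 / 2 * (c1 / 2) \<le> a * \<eta>"
      using a_ge eta_ge c0 c1 by (intro mult_mono) auto
    then have "rate \<le> a * \<eta> / 4" "rate \<le> \<eta> / 8"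
      using eta_ge by (auto simp: decay_rate_def min_def)
    then have 1: "rate * r \<le> a * e / 4" "rate * r \<le> e / 8"
      using mult_right_mono[of rate "a * \<eta> / 4" r] mult_right_mono[of rate "\<eta> / 8" r] r_pos
      by (auto simp: e_def)
    have "rate * r * F \<le> a * e / 4 * F" "rate * r * (r\<^sup>2 * Y) \<le> a * e / 4 * (r\<^sup>2 * Y)"
      "rate * r * V \<le> e / 8 * V"
      by (intro mult_right_mono 1; use nn in simp)+
    then show ?thesis by (simp add: p_def u_def q_def algebra_simps)
  qed
  have "(B / 2 + (2 * c0 + 2 * B) + 4 * B\<^sup>2 / c0) * z
      = B / 2 * z + (2 * c0 + 2 * B) * z + 4 * B\<^sup>2 / c0 * z"
    by (simp only: distrib_right)
  then show ?thesis unfolding e_def[symmetric]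
    using t1 t2 t3 t4 t5 t6 t7 t8 t9 nnp by linarith
qed

lemma rate_pos: "0 < rate"
  using c0 c1 by (rule decay_rate_pos)

lemma rate_le_growth: "rate \<le> growth"
  using c0 c1 pos(3) by (rule decay_rate_le_energy_growth)

lemma growth_pos: "0 < growth"
  using rate_pos rate_le_growth by linarith

text \<open>Since \<open>|g|\<^sup>2 \<le> 2 * L * F\<close> with \<open>L\<close> small, the
  negative gradient term costs at most half of \<open>a * F\<close>, and the squares are
  nonnegative.\<close>

lemma energy_ge:
  assumes "0 \<le> F" "scalar_prod g g \<le> 2 * L * F"
  shows "c0 / 4 * F \<le> energy a \<gamma> h F w y g"
proof -
  have "a * (a - \<gamma>) / 2 * scalar_prod g g \<le> a * (2 * c0 + B) / 2 * (2 * L * F)"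
    using a_gam pos assms c0
    by (intro mult_mono divide_right_mono mult_left_mono) (auto simp: scalar_prod_self_nonneg)
  also have "\<dots> = (a * F) * ((2 * c0 + B) * L)" by simp
  also have "\<dots> \<le> (a * F) * (1 / 2)"
  proof (intro mult_left_mono)
    have "0 \<le> 3 * B * L" "0 \<le> 8 * B\<^sup>2 / c0 * L" using pos c0 L_pos by auto
    then show "(2 * c0 + B) * L \<le> 1 / 2" using L_D by (simp add: algebra_simps)
  qed (use pos assms in auto)
  finally have "a * (a - \<gamma>) / 2 * scalar_prod g g \<le> a * F / 2" by simp
  moreover have "c0 / 4 * F \<le> a / 2 * F" using a_ge assms by (intro mult_right_mono) auto
  moreover have "0 \<le> (scalar_prod (w + h \<cdot>\<^sub>v y) (w + h \<cdot>\<^sub>v y) + scalar_prod w w) / 4"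
    by (simp add: scalar_prod_self_nonneg)
  ultimately show ?thesis unfolding energy_def by linarith
qed

text \<open>The decrease is measured by \<open>S\<close> at the new point, and the same
  \<open>S\<close> bounds the new energy. Hence \<open>(1 + C * r) * ?E' \<le> ?E\<close> with
  \<open>C = rate / growth\<close>.\<close>

lemma energy_contraction:
  assumes v: "v \<in> carrier_vec n" and g: "g \<in> carrier_vec n" and g': "g' \<in> carrier_vec n"
    and y: "y \<in> carrier_vec n"
    and F': "0 \<le> F'" "scalar_prod g' g' \<le> 2 * L * F'"
    and dF: "F' - F \<le> scalar_prod g' v - scalar_prod (g' - g) (g' - g) / (2 * L)"
    and gy: "F' + r\<^sup>2 / 2 * scalar_prod (y + v) (y + v) \<le> scalar_prod g' (y + v)"
    and lip: "scalar_prod (g' - g) (g' - g) \<le> scalar_prod v v"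
  shows "energy a \<gamma> (\<eta> * r) F' (v + \<gamma> \<cdot>\<^sub>v g - (\<eta> * r) \<cdot>\<^sub>v v - a \<cdot>\<^sub>v g') (y + v) g'
    \<le> (1 - rate / (2 * growth) * r) * energy a \<gamma> (\<eta> * r) F (v + \<gamma> \<cdot>\<^sub>v g) y g" (is "?E' \<le> _ * ?E")
proof -
  define D where "D = scalar_prod (g' - g) (g' - g)"
  define N where "N = scalar_prod g' g'"
  define N' where "N' = scalar_prod g g"
  define V where "V = scalar_prod v v"
  define Y where "Y = scalar_prod (y + v) (y + v)"
  define S where "S = F' + r\<^sup>2 * Y + V"
  have nn: "0 \<le> D" "0 \<le> N" "0 \<le> N'" "0 \<le> V" "0 \<le> Y"
    by (auto simp: D_def N_def N'_def V_def Y_def scalar_prod_self_nonneg)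
  have N'_le: "N' \<le> 2 * N + 2 * D"
  proof -
    have "g' - (g' - g) = g" using g g' by auto
    then show ?thesis
      using scalar_prod_self_diff_le[of g' n "g' - g"] g g' by (simp add: N'_def N_def D_def)
  qed
  have young: "a * scalar_prod g' v \<le> V / 16 + 4 * a\<^sup>2 * N"
    using scalar_prod_Young[OF g' v, of a] by (simp add: V_def N_def)
  have young': "- (\<gamma> / 2) * scalar_prod g v \<le> V / 16 + \<gamma>\<^sup>2 * N'"
    using scalar_prod_Young[OF g v, of "- (\<gamma> / 2)"] by (simp add: V_def N'_def power2_eq_square)
  have decrease: "?E' - ?E \<le> - (rate * r * S)"
    unfolding energy_difference[OF v g g' y] S_def
    using dissipation[OF F'(1) nn _ _ _ N'_le young young', of "F' - F" "scalar_prod g' (y + v)"]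
      dF F' gy
    by (simp add: D_def N_def N'_def V_def Y_def)
  \<comment> \<open>The old gradient inside the new momentum is controlled by the new gradient and,
    through \<open>lip\<close>, by the velocity; \<open>L \<le> 1\<close> then gives
    \<open>N \<le> 2 * F'\<close>.\<close>
  have upper: "?E' \<le> growth * S"
  proof -
    let ?w = "v + \<gamma> \<cdot>\<^sub>v g - (\<eta> * r) \<cdot>\<^sub>v v - a \<cdot>\<^sub>v g'"
    define u where "u = \<gamma> \<cdot>\<^sub>v g - a \<cdot>\<^sub>v g'"
    have u: "u \<in> carrier_vec n" using g g' by (simp add: u_def)
    have w: "?w = (1 - \<eta> * r) \<cdot>\<^sub>v v + u"
      using v g g' by (auto simp: u_def algebra_simps)
    have uu: "scalar_prod u u \<le> 2 * (\<gamma>\<^sup>2 * N') + 2 * (a\<^sup>2 * N)"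
      using scalar_prod_self_diff_le[of "\<gamma> \<cdot>\<^sub>v g" n "a \<cdot>\<^sub>v g'"] g g'
      by (simp add: u_def N_def N'_def power2_eq_square algebra_simps)
    have "scalar_prod ?w ?w \<le> 2 * ((1 - \<eta> * r)\<^sup>2 * V) + 2 * scalar_prod u u"
      unfolding w using scalar_prod_self_add_le[of "(1 - \<eta> * r) \<cdot>\<^sub>v v" n u] v u
      by (simp add: V_def power2_eq_square algebra_simps)
    moreover have "(1 - \<eta> * r)\<^sup>2 * V \<le> 1 * V"
      using eta_r nn by (intro mult_right_mono power_le_one) auto
    moreover have "\<gamma>\<^sup>2 * N' \<le> B\<^sup>2 * (2 * N + 2 * V)"
      using gam_sq N'_le lip nn by (intro mult_mono) (auto simp: D_def V_def)
    moreover have "a\<^sup>2 * N \<le> (2 * c0)\<^sup>2 * N"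
      using a_le pos nn by (intro mult_right_mono power_mono) auto
    ultimately have ww: "scalar_prod ?w ?w \<le> 2 * V + 8 * (B\<^sup>2 * N) + 8 * (B\<^sup>2 * V) + 16 * (c0\<^sup>2 * N)"
      using uu by (simp add: algebra_simps power_mult_distrib)
    have N2: "N \<le> 2 * F'"
    proof -
      have "L * F' \<le> 1 * F'" using L_le F' by (intro mult_right_mono) auto
      then show ?thesis using F' by (simp add: N_def)
    qed
    have SS: "F' \<le> S" "r\<^sup>2 * Y \<le> S" "V \<le> S" "0 \<le> S" using F' nn by (auto simp: S_def)
    have "B\<^sup>2 * N \<le> B\<^sup>2 * (2 * F')" "c0\<^sup>2 * N \<le> c0\<^sup>2 * (2 * F')"
      using N2 by (auto intro: mult_left_mono)
    with ww have "3 / 4 * scalar_prod ?w ?w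
        \<le> 3 / 2 * V + 12 * B\<^sup>2 * F' + 6 * B\<^sup>2 * V + 24 * c0\<^sup>2 * F'"
      by (simp add: algebra_simps)
    also have "\<dots> \<le> 2 * S + 12 * B\<^sup>2 * S + 6 * B\<^sup>2 * S + 24 * c0\<^sup>2 * S"
      using SS nn by (intro add_mono mult_left_mono mult_mono) auto
    finally have b1: "3 / 4 * scalar_prod ?w ?w \<le> (2 + 18 * B\<^sup>2 + 24 * c0\<^sup>2) * S"
      by (simp add: algebra_simps)
    have b2: "a * F' \<le> 2 * c0 * S" using a_le SS F' c0 by (intro mult_mono) auto
    have b3: "(\<eta> * r)\<^sup>2 / 2 * Y \<le> 2 * c1\<^sup>2 * S"
    proof -
      have "(\<eta> * r)\<^sup>2 / 2 * Y = \<eta>\<^sup>2 / 2 * (r\<^sup>2 * Y)" by (simp add: power_mult_distrib)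
      also have "\<dots> \<le> (2 * c1)\<^sup>2 / 2 * S"
        using eta_le pos SS nn by (intro mult_mono divide_right_mono power_mono) auto
      finally show ?thesis by (simp add: power_mult_distrib)
    qed
    have b4: "a * \<bar>a - \<gamma>\<bar> / 2 * N \<le> 2 * c0 * (2 * c0 + B) * S"
    proof -
      have "a * \<bar>a - \<gamma>\<bar> / 2 * N \<le> (2 * c0) * (2 * c0 + B) / 2 * (2 * S)"
        using a_le a_gam N2 SS nn pos c0 by (intro mult_mono divide_right_mono) auto
      then show ?thesis by simp
    qed
    have "?E' \<le> a * F' + 3 / 4 * scalar_prod ?w ?w + (\<eta> * r)\<^sup>2 / 2 * Y + a * \<bar>a - \<gamma>\<bar> / 2 * N"
      unfolding Y_def N_def using v g g' y pos by (intro energy_le[where n = n]) auto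
    with b1 b2 b3 b4 show ?thesis unfolding energy_growth_def by (simp add: algebra_simps)
  qed
  define C where "C = rate / growth"
  have C: "0 < C" "C \<le> 1" using rate_pos growth_pos rate_le_growth by (auto simp: C_def)
  have E'0: "0 \<le> ?E'"
  proof -
    have "0 \<le> c0 / 4 * F'" using c0 F' by simp
    then show ?thesis using energy_ge[OF F'] by (rule order_trans)
  qed
  have "C * r * ?E' \<le> C * r * (growth * S)" using upper C r_pos by (intro mult_left_mono) auto
  also have "\<dots> = rate * r * S" using growth_pos by (simp add: C_def)
  finally have E: "(1 + C * r) * ?E' \<le> ?E" using decrease by (simp add: algebra_simps)
  have Cr: "0 < C * r" "C * r \<le> 1" using C r_pos r_le by (auto simp: mult_le_one)
  \<comment> \<open>For \<open>t = C * r\<close> between 0 and 1,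
    \<open>(1 - t / 2) * (1 + t) = 1 + t * (1 - t) / 2\<close>. Thus dividing by
    \<open>1 + t\<close> costs half of the rate.\<close>
  have "1 \<le> (1 - C / 2 * r) * (1 + C * r)"
  proof -
    have "0 \<le> C * r * (1 - C * r)" using Cr by simp
    then show ?thesis by (simp add: algebra_simps)
  qed
  from mult_right_mono[OF this E'0]
  have "?E' \<le> (1 - C / 2 * r) * ((1 + C * r) * ?E')" by (simp only: mult.assoc mult_1)
  also have "\<dots> \<le> (1 - C / 2 * r) * ?E" using E Cr by (intro mult_left_mono) auto
  finally show ?thesis by (simp add: C_def mult.commute)
qed

end

section \<open>Convergence of the iterates\<close>

lemma momentum_identity:
  assumes "x \<in> carrier_vec n" "x' \<in> carrier_vec n" "g \<in> carrier_vec n" "g' \<in> carrier_vec n"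
  shows "x - (a * s) \<cdot>\<^sub>v g + b \<cdot>\<^sub>v (x - x') - (c * s) \<cdot>\<^sub>v (g - g') - x + c \<cdot>\<^sub>v (s \<cdot>\<^sub>v g)
    = x - x' + c \<cdot>\<^sub>v (s \<cdot>\<^sub>v g') - (1 - b) \<cdot>\<^sub>v (x - x') - a \<cdot>\<^sub>v (s \<cdot>\<^sub>v (g :: real Matrix.vec))"
  using assms by (intro eq_vecI) (auto simp: algebra_simps)

lemma first_step_identity:
  assumes "x \<in> carrier_vec n" "g \<in> carrier_vec n"
  shows "x - (h * s) \<cdot>\<^sub>v g - x + c \<cdot>\<^sub>v (s \<cdot>\<^sub>v g) = (c - h) \<cdot>\<^sub>v (s \<cdot>\<^sub>v (g :: real Matrix.vec))"
  using assms by (intro eq_vecI) (auto simp: algebra_simps)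

lemma smult_vec_diff:
  assumes "g \<in> carrier_vec n" "g' \<in> carrier_vec n"
  shows "s \<cdot>\<^sub>v g - s \<cdot>\<^sub>v g' = s \<cdot>\<^sub>v (g - (g' :: real Matrix.vec))"
  using assms by (intro eq_vecI) (auto simp: algebra_simps)

text \<open>The function is rescaled by \<open>s\<close>, so \<open>damped_regime\<close> receives
  \<open>s * L\<close>. Defining \<open>\<eta>\<close> as a quotient makes
  \<open>1 - \<eta> * r\<close> exactly the momentum coefficient
  \<open>1 - c1 * r + R2 r\<close>.\<close>

locale accelerated_iteration = S1_function n \<mu> L f +
  damped_regime c0 c1 B "c0 + R1 r" "c2 * sqrt c0 - c0 / 2 + R3 r" "(c1 * r - R2 r) / r" r "s * L"
  for n \<mu> L f c0 c1 B and R1 R2 R3 :: "real \<Rightarrow> real" and c2 r s +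
  fixes h1 :: "real \<Rightarrow> real" and x0 xstar :: "real Matrix.vec" and H :: real
  assumes s_pos: "0 < s" and r_def: "r = sqrt (\<mu> * s)"
    and x0: "x0 \<in> carrier_vec n"
    and min: "is_arg_min f (\<lambda>x. x \<in> carrier_vec n) xstar"
    and h1_le: "\<bar>h1 r\<bar> \<le> H"
begin

abbreviation "X \<equiv> iterates c0 c1 c2 R1 R2 R3 h1 n f \<mu> s x0"
abbreviation "a \<equiv> c0 + R1 r"
abbreviation "\<gamma> \<equiv> c2 * sqrt c0 - c0 / 2 + R3 r"
abbreviation "\<eta> \<equiv> (c1 * r - R2 r) / r"
abbreviation "G k \<equiv> s \<cdot>\<^sub>v grad (X k)"
abbreviation "gap k \<equiv> s * (f (X k) - f xstar)"
abbreviation "v k \<equiv> X (Suc k) - X k"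
abbreviation "y k \<equiv> X k - xstar"
abbreviation "E k \<equiv> energy a \<gamma> (\<eta> * r) (gap k) (v k + \<gamma> \<cdot>\<^sub>v G k) (y k) (G k)"

lemma r_sq: "r\<^sup>2 = \<mu> * s"
  using mu_pos s_pos by (simp add: r_def)

lemma X_carrier: "X k \<in> carrier_vec n"
proof -
  have "X k \<in> carrier_vec n \<and> X (Suc k) \<in> carrier_vec n"
    by (induction k) (auto simp: x0 Let_def)
  then show ?thesis ..
qed

text \<open>Adding \<open>\<gamma> G\<close> to the velocity absorbs the gradient-difference term of
  the algorithm, which leaves the form required by \<open>energy_difference\<close>.\<close>

lemma velocity_step:
  "v (Suc k) + \<gamma> \<cdot>\<^sub>v G (Suc k)
    = v k + \<gamma> \<cdot>\<^sub>v G k - (\<eta> * r) \<cdot>\<^sub>v v k - a \<cdot>\<^sub>v G (Suc k)"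
proof -
  define x where "x = X (Suc k)"
  define x' where "x' = X k"
  have c: "x \<in> carrier_vec n" "x' \<in> carrier_vec n" "grad x \<in> carrier_vec n" "grad x' \<in> carrier_vec n"
    by (auto simp: x_def x'_def X_carrier)
  have e: "\<eta> * r = c1 * r - R2 r" using r_pos by simp
  have "X (Suc (Suc k)) = x - (a * s) \<cdot>\<^sub>v grad x + (1 - c1 * r + R2 r) \<cdot>\<^sub>v (x - x')
      - (\<gamma> * s) \<cdot>\<^sub>v (grad x - grad x')"
    by (simp add: Let_def x_def x'_def r_def)
  moreover have "1 - (1 - c1 * r + R2 r) = c1 * r - R2 r" by simp
  ultimately show ?thesis unfolding e x_def[symmetric] x'_def[symmetric]
    using momentum_identity[OF c, of a s "1 - c1 * r + R2 r" \<gamma>] by simp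
qed

lemma gap_nonneg: "0 \<le> gap k"
  using minimizer_le[OF min X_carrier] s_pos by simp

lemma G_sq_le: "scalar_prod (G k) (G k) \<le> 2 * (s * L) * gap k"
proof -
  have "s * (s * scalar_prod (grad (X k)) (grad (X k))) \<le> s * (s * (2 * L * (f (X k) - f xstar)))"
    using grad_sq_le[OF min X_carrier] s_pos by (intro mult_left_mono) auto
  then show ?thesis using X_carrier[of k] by (simp add: algebra_simps)
qed

text \<open>Co-coercivity and strong convexity are multiplied by \<open>s\<close> to pass to the
  rescaled quantities; in the Lipschitz bound, \<open>s * L \<le> 1\<close> removes the
  constant.\<close>

lemma E_step: "E (Suc k) \<le> (1 - rate / (2 * growth) * r) * E k"
proof -
  note c = X_carrier[of k] X_carrier[of "Suc k"] minimizer_carrier[OF min]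
  let ?d = "grad (X (Suc k)) - grad (X k)"
  have yv: "y k + v k = y (Suc k)" using c by auto
  have GG: "G (Suc k) - G k = s \<cdot>\<^sub>v ?d" using c by (intro smult_vec_diff[of _ n]) auto
  have cd: "?d \<in> carrier_vec n" using c by simp
  have dd: "scalar_prod (G (Suc k) - G k) (G (Suc k) - G k) = s * (s * scalar_prod ?d ?d)"
    unfolding GG using cd by simp
  have 1: "gap (Suc k) - gap k \<le> scalar_prod (G (Suc k)) (v k)
      - scalar_prod (G (Suc k) - G k) (G (Suc k) - G k) / (2 * (s * L))"
  proof -
    have "s * (f (X (Suc k)) - f (X k)) \<le> s * (scalar_prod (grad (X (Suc k))) (v k)
      - 1 / (2 * L) * scalar_prod ?d ?d)"
      using cocoercive[OF c(2) c(1)] s_pos by (intro mult_left_mono) auto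
    then show ?thesis using c s_pos L_pos unfolding dd by (simp add: algebra_simps)
  qed
  have 2: "gap (Suc k) + r\<^sup>2 / 2 * scalar_prod (y k + v k) (y k + v k)
      \<le> scalar_prod (G (Suc k)) (y k + v k)"
    unfolding yv r_sq
    using mult_left_mono[OF grad_minimizer_ge[OF min c(2)], of s] s_pos c
    by (simp add: algebra_simps)
  have 3: "scalar_prod (G (Suc k) - G k) (G (Suc k) - G k) \<le> scalar_prod (v k) (v k)"
  proof -
    have "s * vnorm ?d \<le> s * (L * vnorm (v k))"
      using grad_lipschitz[OF c(1) c(2)] s_pos by (intro mult_left_mono) auto
    also have "\<dots> = (s * L) * vnorm (v k)" by simp
    also have "\<dots> \<le> 1 * vnorm (v k)" using L_le by (intro mult_right_mono) (auto simp: vnorm_nonneg)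
    finally have "(s * vnorm ?d)\<^sup>2 \<le> (vnorm (v k))\<^sup>2"
      using s_pos vnorm_nonneg[of ?d] by (intro power_mono) auto
    then show ?thesis unfolding dd by (simp add: vnorm_sq[symmetric] power2_eq_square mult_ac)
  qed
  have "energy a \<gamma> (\<eta> * r) (gap (Suc k)) (v k + \<gamma> \<cdot>\<^sub>v G k - (\<eta> * r) \<cdot>\<^sub>v v k - a \<cdot>\<^sub>v G (Suc k)) (y k + v k) (G (Suc k))
    \<le> (1 - rate / (2 * growth) * r) * E k"
    using c gap_nonneg G_sq_le 1 2 3
    by (intro energy_contraction[where n = n and g = "G k"]) auto
  then show ?thesis unfolding velocity_step yv .
qed

text \<open>Since \<open>v 0\<close> is the forward difference \<open>X 1 - X 0\<close>, the initial
  momentum is \<open>(\<gamma> - h1 r) G 0\<close>, and \<open>H\<close> enters the constant here.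
  Every term carries a factor \<open>s * L\<close>, for the distance term because
  \<open>r\<^sup>2 = \<mu> * s \<le> s * L\<close>; cancelling \<open>s\<close> later leaves the
  factor \<open>L\<close>.\<close>

lemma E_initial:
  "E 0 \<le> (c0 + 3 / 4 * (B + H)\<^sup>2 + 2 * c1\<^sup>2 + c0 * (2 * c0 + B)) * (s * L * scalar_prod (y 0) (y 0))"
proof -
  define Y where "Y = scalar_prod (y 0) (y 0)"
  define N where "N = scalar_prod (G 0) (G 0)"
  have c: "xstar \<in> carrier_vec n" "grad x0 \<in> carrier_vec n"
    using x0 minimizer_carrier[OF min] by auto
  have nn: "0 \<le> Y" "0 \<le> N" "0 \<le> s * L * Y"
    using L_pos s_pos by (auto simp: Y_def N_def scalar_prod_self_nonneg)
  have gap: "gap 0 \<le> s * L * Y / 2"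
    using mult_left_mono[OF gap_le[OF min x0], of s] s_pos by (simp add: Y_def)
  have N: "N \<le> s * L * Y"
  proof -
    have "N \<le> (2 * (s * L)) * gap 0" using G_sq_le[of 0] by (simp only: N_def)
    also have "\<dots> \<le> 2 * gap 0"
      using L_le gap_nonneg[of 0] by (intro mult_right_mono) auto
    finally show ?thesis using gap by simp
  qed
  have w: "v 0 + \<gamma> \<cdot>\<^sub>v G 0 = (\<gamma> - h1 r) \<cdot>\<^sub>v G 0"
    using first_step_identity[OF x0 c(2), of "h1 r" s \<gamma>] by (simp add: r_def)
  have "(\<gamma> - h1 r)\<^sup>2 \<le> (B + H)\<^sup>2"
  proof (rule power2_le_iff_abs_le[THEN iffD2])
    show "\<bar>\<gamma> - h1 r\<bar> \<le> B + H" using gam h1_le by linarith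
    then show "0 \<le> B + H" by linarith
  qed
  then have "(\<gamma> - h1 r)\<^sup>2 * N \<le> (B + H)\<^sup>2 * (s * L * Y)" using N nn by (intro mult_mono) auto
  then have ww: "scalar_prod (v 0 + \<gamma> \<cdot>\<^sub>v G 0) (v 0 + \<gamma> \<cdot>\<^sub>v G 0) \<le> (B + H)\<^sup>2 * (s * L * Y)"
    unfolding w using c by (simp add: N_def power2_eq_square mult_ac)
  have b1: "a * gap 0 \<le> c0 * (s * L * Y)"
  proof -
    have "a * gap 0 \<le> 2 * c0 * (s * L * Y / 2)"
      using a_le gap gap_nonneg[of 0] c0 by (intro mult_mono) auto
    then show ?thesis by simp
  qed
  have b2: "(\<eta> * r)\<^sup>2 / 2 * Y \<le> 2 * c1\<^sup>2 * (s * L * Y)"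
  proof -
    have "r\<^sup>2 \<le> s * L" using r_sq mu_le s_pos by simp
    then have 1: "r\<^sup>2 * Y \<le> s * L * Y" using nn by (intro mult_right_mono) auto
    have 2: "\<eta>\<^sup>2 \<le> (2 * c1)\<^sup>2" using eta_le pos by (intro power_mono) auto
    have "(\<eta> * r)\<^sup>2 / 2 * Y = \<eta>\<^sup>2 / 2 * (r\<^sup>2 * Y)"
      unfolding power_mult_distrib by simp
    also have "\<dots> \<le> (2 * c1)\<^sup>2 / 2 * (s * L * Y)"
      by (rule mult_mono[OF divide_right_mono[OF 2] 1]) (use nn in auto)
    also have "\<dots> = 2 * c1\<^sup>2 * (s * L * Y)" by (simp add: power_mult_distrib)
    finally show ?thesis .
  qed
  have b3: "a * \<bar>a - \<gamma>\<bar> / 2 * N \<le> c0 * (2 * c0 + B) * (s * L * Y)"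
  proof -
    have "a * \<bar>a - \<gamma>\<bar> / 2 * N \<le> (2 * c0) * (2 * c0 + B) / 2 * (s * L * Y)"
      using a_le a_gam N nn pos c0 by (intro mult_mono divide_right_mono) auto
    then show ?thesis by simp
  qed
  have "E 0 \<le> a * gap 0 + 3 / 4 * scalar_prod (v 0 + \<gamma> \<cdot>\<^sub>v G 0) (v 0 + \<gamma> \<cdot>\<^sub>v G 0)
      + (\<eta> * r)\<^sup>2 / 2 * Y + a * \<bar>a - \<gamma>\<bar> / 2 * N"
    unfolding Y_def N_def using x0 c pos
    by (intro energy_le[where n = n]) auto
  also have "\<dots> \<le> c0 * (s * L * Y) + 3 / 4 * ((B + H)\<^sup>2 * (s * L * Y))
      + 2 * c1\<^sup>2 * (s * L * Y) + c0 * (2 * c0 + B) * (s * L * Y)"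
    using b1 b2 b3 ww by linarith
  finally show ?thesis unfolding Y_def by (simp only: distrib_right mult.assoc)
qed

theorem gap_decay:
  "f (X k) - f xstar \<le> 4 / c0 * (c0 + 3 / 4 * (B + H)\<^sup>2 + 2 * c1\<^sup>2 + c0 * (2 * c0 + B)) * L
    * (vnorm (x0 - xstar))\<^sup>2 * (1 - rate / (2 * growth) * r) ^ k"
proof -
  define M where "M = c0 + 3 / 4 * (B + H)\<^sup>2 + 2 * c1\<^sup>2 + c0 * (2 * c0 + B)"
  define \<rho> where "\<rho> = 1 - rate / (2 * growth) * r"
  have "rate / (2 * growth) * r \<le> 1 * 1"
    using rate_pos growth_pos rate_le_growth r_le r_pos by (intro mult_mono) auto
  then have \<rho>: "0 \<le> \<rho>" by (simp add: \<rho>_def)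
  have "E k \<le> \<rho> ^ k * E 0"
  proof (induction k)
    case (Suc k)
    have "E (Suc k) \<le> \<rho> * E k" unfolding \<rho>_def by (rule E_step)
    also have "\<dots> \<le> \<rho> * (\<rho> ^ k * E 0)" using Suc.IH \<rho> by (rule mult_left_mono)
    finally show ?case by simp
  qed simp
  also have "\<dots> \<le> \<rho> ^ k * (M * (s * L * scalar_prod (y 0) (y 0)))"
    using E_initial \<rho> unfolding M_def by (intro mult_left_mono) auto
  finally have "c0 / 4 * gap k \<le> \<rho> ^ k * (M * (s * L * scalar_prod (y 0) (y 0)))"
    using energy_ge[OF gap_nonneg G_sq_le] by (rule order_trans[rotated])
  then have "s * (f (X k) - f xstar) \<le> s * (4 / c0 * M * L * scalar_prod (y 0) (y 0) * \<rho> ^ k)"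
    using c0 by (simp add: field_simps)
  then have "f (X k) - f xstar \<le> 4 / c0 * M * L * scalar_prod (y 0) (y 0) * \<rho> ^ k"
    by (rule mult_left_le_imp_le[OF _ s_pos])
  then show ?thesis
    by (simp add: M_def \<rho>_def vnorm_sq)
qed

end

section \<open>From asymptotic conditions to explicit constants\<close>

lemma bigo_sqrt_bound:
  fixes R :: "real \<Rightarrow> real"
  assumes "(\<lambda>q. R (sqrt q)) \<in> O[at_right 0](\<lambda>q. (sqrt q) ^ m)"
  obtains K \<rho> where "0 < K" "0 < \<rho>" "\<And>r. 0 < r \<Longrightarrow> r < \<rho> \<Longrightarrow> \<bar>R r\<bar> \<le> K * r ^ m"
proof -
  obtain K where K: "0 < K" "\<forall>\<^sub>F q in at_right 0. norm (R (sqrt q)) \<le> K * norm ((sqrt q) ^ m)"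
    using assms by (elim landau_o.bigE)
  then obtain b where b: "0 < b" "\<And>q. 0 < q \<Longrightarrow> q < b \<Longrightarrow> norm (R (sqrt q)) \<le> K * norm ((sqrt q) ^ m)"
    by (auto simp: eventually_at_right_field)
  show thesis
  proof (rule that[of K "sqrt b"])
    fix r :: real assume r: "0 < r" "r < sqrt b"
    \<comment> \<open>The substitution \<open>q = r\<^sup>2\<close> moves the bound to the variable
      in which \<open>R\<close> is evaluated.\<close>
    have "r\<^sup>2 < b" using r b(1) by (metis abs_of_pos real_sqrt_abs real_sqrt_less_iff)
    then show "\<bar>R r\<bar> \<le> K * r ^ m" using b(2)[of "r\<^sup>2"] r by simp
  qed (use K b in auto)
qed

text \<open>Local power series give continuity, and the interval is compact. The bound is the only
  information on \<open>h1\<close> that enters the constant \<open>C\<close>.\<close>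

lemma real_analytic_on_bounded:
  assumes h: "real_analytic_on h {0..c}"
  shows "\<exists>H. \<forall>x\<in>{0..c}. \<bar>h x\<bar> \<le> H"
proof -
  have "continuous_on {0..c} h"
  proof (rule continuous_at_imp_continuous_on, rule ballI)
    fix a assume "a \<in> {0..c}"
    then obtain F where "(\<lambda>t. h (a + t)) has_fps_expansion F"
      using h unfolding real_analytic_on_def by blast
    then have "isCont (\<lambda>t. h (a + t)) 0" by (rule has_fps_expansion_imp_continuous)
    then have "(\<lambda>t. h (a + t)) \<midarrow>0\<rightarrow> h a" by (simp add: isCont_def)
    then show "isCont h a" by (simp add: isCont_iff)
  qed
  then have "bounded (h ` {0..c})"
    by (intro compact_imp_bounded compact_continuous_image) auto
  then show ?thesis by (auto simp: bounded_iff)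
qed

lemma eventually_linear_le:
  fixes A c :: real
  assumes "0 < c"
  shows "\<forall>\<^sub>F x in at_right 0. A * x \<le> c"
proof -
  have "((\<lambda>x. A * x) \<longlongrightarrow> A * 0) (at_right 0)" by (intro tendsto_intros)
  then have "\<forall>\<^sub>F x in at_right 0. A * x < c" using assms by (intro order_tendstoD(2)) auto
  then show ?thesis by eventually_elim simp
qed

text \<open>Both parts of the theorem are instances: the last hypothesis on \<open>s\<close> is void when
  \<open>c2\<^sup>2 \<ge> c0\<close>, and otherwise it is what the restriction \<open>s \<le> C0 * \<mu> / L\<^sup>2\<close> provides.\<close>

lemma accelerated_convergence:
  fixes c0 c1 c2 q0 :: real and R1 R2 R3 :: "real \<Rightarrow> real"
  assumes c0: "c0 > 0" and c1: "c1 > 0" and q0: "q0 > 0"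
    and R1: "(\<lambda>q. R1 (sqrt q)) \<in> O[at_right 0](\<lambda>q. sqrt q)"
    and R2: "(\<lambda>q. R2 (sqrt q)) \<in> O[at_right 0](\<lambda>q. q)"
    and R3: "(\<lambda>q. R3 (sqrt q)) \<in> O[at_right 0](\<lambda>q. sqrt q)"
  shows "\<exists>C0>0. \<exists>\<theta>>0. \<exists>C1>0. \<forall>h1. real_analytic_on h1 {0..sqrt q0} \<longrightarrow>
        (\<exists>C>0. \<forall>(n::nat) \<mu> L f x0 xstar s.
          0 < \<mu> \<longrightarrow> \<mu> \<le> L \<longrightarrow> f \<in> S1 n \<mu> L \<longrightarrow> x0 \<in> carrier_vec n \<longrightarrow>
          is_arg_min f (\<lambda>x. x \<in> carrier_vec n) xstar \<longrightarrow>
          0 < s \<longrightarrow> s * L \<le> C0 \<longrightarrow> s * L * (2 * sqrt c0 * (sqrt c0 - c2)) \<le> \<theta> * sqrt (\<mu> * s) \<longrightarrow>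
          \<mu> * s \<le> q0 \<and>
          (\<forall>k. f (iterates c0 c1 c2 R1 R2 R3 h1 n f \<mu> s x0 k) - f xstar
             \<le> C * L * (vnorm (x0 - xstar))\<^sup>2 * (1 - C1 * sqrt (\<mu> * s)) ^ k))"
proof -
  obtain K1 \<rho>1 where K1: "0 < K1" "0 < \<rho>1" "\<And>r. 0 < r \<Longrightarrow> r < \<rho>1 \<Longrightarrow> \<bar>R1 r\<bar> \<le> K1 * r"
    using bigo_sqrt_bound[of R1 1] R1 by auto
  obtain K3 \<rho>3 where K3: "0 < K3" "0 < \<rho>3" "\<And>r. 0 < r \<Longrightarrow> r < \<rho>3 \<Longrightarrow> \<bar>R3 r\<bar> \<le> K3 * r"
    using bigo_sqrt_bound[of R3 1] R3 by auto
  \<comment> \<open>The identity fails for negative \<open>q\<close>, but the filter sees only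
    positive ones.\<close>
  have "\<forall>\<^sub>F q in at_right 0. q = (sqrt q) ^ 2"
    using eventually_at_right_less[of "0::real"] by eventually_elim simp
  then have "(\<lambda>q. R2 (sqrt q)) \<in> O[at_right 0](\<lambda>q. (sqrt q) ^ 2)"
    using R2 by (subst landau_o.big.cong[symmetric])
  then obtain K2 \<rho>2 where K2: "0 < K2" "0 < \<rho>2" "\<And>r. 0 < r \<Longrightarrow> r < \<rho>2 \<Longrightarrow> \<bar>R2 r\<bar> \<le> K2 * r\<^sup>2"
    using bigo_sqrt_bound[of R2 2] by blast
  define \<beta> where "\<beta> = c2 * sqrt c0 - c0 / 2"
  \<comment> \<open>\<open>\<beta>\<close> is \<open>\<gamma>\<close> without its correction; the
    added 1 makes room for \<open>R3 r\<close>.\<close>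
  define B where "B = \<bar>\<beta>\<bar> + 1"
  have B: "0 \<le> B" by (simp add: B_def)
  \<comment> \<open>A single \<open>e\<close> will bound both \<open>r\<close> and
    \<open>s * L\<close>, and every smallness requirement is linear in it. Halving
    \<open>\<rho>1\<close>, \<open>\<rho>2\<close>, \<open>\<rho>3\<close> makes \<open>r\<close>
    strictly smaller than each of them.\<close>
  have "\<forall>\<^sub>F e in at_right 0. 0 < e \<and> 1 * e \<le> 1 \<and> 2 * c1 * e \<le> 1 \<and> 1 * e \<le> sqrt q0
      \<and> 1 * e \<le> \<rho>1 / 2 \<and> 1 * e \<le> \<rho>2 / 2 \<and> 1 * e \<le> \<rho>3 / 2
      \<and> K1 * e \<le> c0 / 2 \<and> K2 * e \<le> c1 / 2 \<and> K3 * e \<le> 1 \<and> (K1 + 2 * K3) * e \<le> c1 / 128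
      \<and> 256 * c0 * e \<le> 1 \<and> 128 * B\<^sup>2 * e \<le> c0 \<and> (5 * B + 4 * c0 + 8 * B\<^sup>2 / c0) * e \<le> 1"
    using c0 c1 q0 K1(2) K2(2) K3(2)
    by (intro eventually_conj eventually_linear_le eventually_at_right_less) auto
  from eventually_happens'[OF trivial_limit_at_right_real this] obtain e where e: "0 < e" "e \<le> 1" "2 * c1 * e \<le> 1" "e \<le> sqrt q0" "e \<le> \<rho>1 / 2" "e \<le> \<rho>2 / 2"
      "e \<le> \<rho>3 / 2" "K1 * e \<le> c0 / 2" "K2 * e \<le> c1 / 2" "K3 * e \<le> 1" "(K1 + 2 * K3) * e \<le> c1 / 128"
      "256 * c0 * e \<le> 1" "128 * B\<^sup>2 * e \<le> c0" "(5 * B + 4 * c0 + 8 * B\<^sup>2 / c0) * e \<le> 1"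
    by auto
  define C1 where "C1 = decay_rate c0 c1 / (2 * energy_growth c0 c1 B)"
  have C1: "0 < C1"
    using decay_rate_pos[OF c0 c1] decay_rate_le_energy_growth[OF c0 c1 B] by (simp add: C1_def)
  show ?thesis
  \<comment> \<open>From \<open>s * L \<le> e\<^sup>2\<close> follow \<open>r \<le> e\<close>, as
    \<open>\<mu> \<le> L\<close>, and \<open>s * L \<le> e\<close>, as \<open>e \<le> 1\<close>. The
    witness \<open>c1 / 128\<close> is half of the constant in \<open>balance\<close>; the other
    half is kept for \<open>R1\<close> and \<open>R3\<close>. All witnesses are fixed before
    \<open>h1\<close>.\<close>
  proof (rule exI[of _ "e\<^sup>2"], intro conjI, use e in simp, rule exI[of _ "c1 / 128"], intro conjI,
      use c1 in simp, rule exI[of _ C1], intro conjI C1 allI impI)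
    fix h1 assume "real_analytic_on h1 {0..sqrt q0}"
    then obtain H where H: "\<And>x. x \<in> {0..sqrt q0} \<Longrightarrow> \<bar>h1 x\<bar> \<le> H"
      using real_analytic_on_bounded by blast
    define C where "C = 4 / c0 * (c0 + 3 / 4 * (B + H)\<^sup>2 + 2 * c1\<^sup>2 + c0 * (2 * c0 + B))"
    have "0 < c0 + 3 / 4 * (B + H)\<^sup>2 + 2 * c1\<^sup>2 + c0 * (2 * c0 + B)"
      using c0 B by (intro add_pos_nonneg) auto
    then have C: "0 < C" using c0 unfolding C_def by (intro mult_pos_pos) auto
    show "\<exists>C>0. \<forall>(n::nat) \<mu> L f x0 xstar s.
          0 < \<mu> \<longrightarrow> \<mu> \<le> L \<longrightarrow> f \<in> S1 n \<mu> L \<longrightarrow> x0 \<in> carrier_vec n \<longrightarrow>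
          is_arg_min f (\<lambda>x. x \<in> carrier_vec n) xstar \<longrightarrow>
          0 < s \<longrightarrow> s * L \<le> e\<^sup>2 \<longrightarrow> s * L * (2 * sqrt c0 * (sqrt c0 - c2)) \<le> c1 / 128 * sqrt (\<mu> * s) \<longrightarrow>
          \<mu> * s \<le> q0 \<and>
          (\<forall>k. f (iterates c0 c1 c2 R1 R2 R3 h1 n f \<mu> s x0 k) - f xstar
             \<le> C * L * (vnorm (x0 - xstar))\<^sup>2 * (1 - C1 * sqrt (\<mu> * s)) ^ k)"
    proof (rule exI[of _ C], intro conjI C allI impI)
      fix n :: nat and \<mu> L s :: real and f and x0 xstar :: "real Matrix.vec"
      assume mu: "0 < \<mu>" "\<mu> \<le> L" and f: "f \<in> S1 n \<mu> L" and x0: "x0 \<in> carrier_vec n"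
        and min: "is_arg_min f (\<lambda>x. x \<in> carrier_vec n) xstar" and s: "0 < s"
        and sL: "s * L \<le> e\<^sup>2"
        and bal: "s * L * (2 * sqrt c0 * (sqrt c0 - c2)) \<le> c1 / 128 * sqrt (\<mu> * s)"
      define r where "r = sqrt (\<mu> * s)"
      have r: "0 < r" using mu s by (simp add: r_def)
      have "\<mu> * s \<le> s * L" using mu s by simp
      then have "\<mu> * s \<le> e\<^sup>2" using sL by linarith
      then have "r\<^sup>2 \<le> e\<^sup>2" using mu s by (simp add: r_def)
      then have re: "r \<le> e" by (rule power2_le_imp_le) (use e in simp)
      have "r\<^sup>2 \<le> (sqrt q0)\<^sup>2" using re e(4) r by (intro power_mono) auto
      then show "\<mu> * s \<le> q0" using mu s q0 by (simp add: r_def)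
      have l: "0 < s * L" "s * L \<le> e"
      proof -
        have "e\<^sup>2 \<le> e" using e(1,2) by (simp add: power2_eq_square mult_left_le)
        then show "s * L \<le> e" using sL by simp
      qed (use mu s in simp)
      have scale: "A * x \<le> c" if "A * e \<le> c" "0 \<le> A" "x \<le> e" for A x c :: real
        using mult_left_mono[OF that(3) that(2)] that(1) by linarith
      have Rb: "\<bar>R1 r\<bar> \<le> K1 * r" "\<bar>R2 r\<bar> \<le> K2 * r\<^sup>2" "\<bar>R3 r\<bar> \<le> K3 * r"
        using K1 K2 K3 e re r by auto
      have R1r: "\<bar>R1 r\<bar> \<le> c0 / 2" using Rb(1) scale[OF e(8) _ re] K1(1) by linarith
      have R3r: "\<bar>R3 r\<bar> \<le> 1" using Rb(3) scale[OF e(10) _ re] K3(1) by linarith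
      have R2r: "\<bar>R2 r / r\<bar> \<le> c1 / 2"
      proof -
        have "\<bar>R2 r / r\<bar> \<le> K2 * r" using Rb(2) r by (simp add: field_simps power2_eq_square)
        then show ?thesis using scale[OF e(9) _ re] K2(1) by linarith
      qed
      have eta: "(c1 * r - R2 r) / r = c1 - R2 r / r" using r by (simp add: field_simps)
      \<comment> \<open>The leading part \<open>c0 - 2 * \<beta>\<close> is covered by the
        hypothesis \<open>bal\<close>. The correction \<open>R1 r - 2 * R3 r\<close> is of order
        \<open>r\<close>, and the small factor \<open>s * L\<close> brings it below
        \<open>c1 / 128 * r\<close>.\<close>
      have balance: "s * L * (c0 + R1 r - 2 * (\<beta> + R3 r)) \<le> c1 / 64 * r"
      proof -
        have "R1 r - 2 * R3 r \<le> (K1 + 2 * K3) * r" using Rb by (simp add: algebra_simps abs_le_iff)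
        then have "s * L * (R1 r - 2 * R3 r) \<le> s * L * ((K1 + 2 * K3) * r)"
          using l by (intro mult_left_mono) auto
        also have "\<dots> = ((K1 + 2 * K3) * (s * L)) * r" by simp
        also have "\<dots> \<le> c1 / 128 * r"
          using scale[OF e(11) _ l(2)] K1(1) K3(1) r by (intro mult_right_mono) auto
        finally have 1: "s * L * (R1 r - 2 * R3 r) \<le> c1 / 128 * r" .
        have "c0 - 2 * \<beta> = 2 * sqrt c0 * (sqrt c0 - c2)"
          using c0 by (simp add: \<beta>_def algebra_simps)
        then have 2: "s * L * (c0 - 2 * \<beta>) \<le> c1 / 128 * r" using bal by (simp add: r_def)
        have "s * L * (c0 + R1 r - 2 * (\<beta> + R3 r)) = s * L * (c0 - 2 * \<beta>) + s * L * (R1 r - 2 * R3 r)"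
          by (simp add: algebra_simps)
        then show ?thesis using 1 2 by simp
      qed
      interpret accelerated_iteration n \<mu> L f c0 c1 B R1 R2 R3 c2 r s h1 x0 xstar H
      proof
        show "256 * c0 * (s * L) \<le> 1" using scale[OF e(12) _ l(2)] c0 by simp
        show "128 * B\<^sup>2 * (s * L) \<le> c0" using scale[OF e(13) _ l(2)] by simp
        show "(5 * B + 4 * c0 + 8 * B\<^sup>2 / c0) * (s * L) \<le> 1" using scale[OF e(14) _ l(2)] c0 B by simp
        show "2 * c1 * r \<le> 1" using scale[OF e(3) _ re] c1 by simp
        show "c1 / 2 \<le> (c1 * r - R2 r) / r" "(c1 * r - R2 r) / r \<le> 2 * c1"
          unfolding eta using R2r c1 by linarith+
        show "\<bar>c2 * sqrt c0 - c0 / 2 + R3 r\<bar> \<le> B"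
          unfolding \<beta>_def[symmetric] B_def using R3r by linarith
        show "s * L * (c0 + R1 r - 2 * (c2 * sqrt c0 - c0 / 2 + R3 r)) \<le> c1 / 64 * r"
          using balance by (simp only: \<beta>_def)
        show "\<bar>h1 r\<bar> \<le> H" using H re e(4) r by simp
        show "c0 / 2 \<le> c0 + R1 r" "c0 + R1 r \<le> 2 * c0" using R1r c0 by linarith+
        show "r \<le> 1" "s * L \<le> 1" using re l e(2) by linarith+
        show "r = sqrt (\<mu> * s)" by (rule r_def)
      qed (use mu f x0 min s c0 c1 r l in auto)
      fix k
      show "f (iterates c0 c1 c2 R1 R2 R3 h1 n f \<mu> s x0 k) - f xstar
             \<le> C * L * (vnorm (x0 - xstar))\<^sup>2 * (1 - C1 * sqrt (\<mu> * s)) ^ k"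
        unfolding C_def C1_def r_def[symmetric] by (rule gap_decay)
    qed
  qed
qed

theorem corollary1:
  fixes c0 c1 c2 q0 :: real and R1 R2 R3 :: "real \<Rightarrow> real"
  assumes "c0 > 0" and "c1 > 0" and "c2 > 0" and "q0 > 0"
    and "real_analytic_on R1 {0..sqrt q0}"
    and "real_analytic_on R2 {0..sqrt q0}"
    and "real_analytic_on R3 {0..sqrt q0}"
    and "(\<lambda>q. R1 (sqrt q)) \<in> O[at_right 0](\<lambda>q. sqrt q)"
    and "(\<lambda>q. R2 (sqrt q)) \<in> O[at_right 0](\<lambda>q. q)"
    and "(\<lambda>q. R3 (sqrt q)) \<in> O[at_right 0](\<lambda>q. sqrt q)"
  shows
    "(c0 / 4 \<le> c2\<^sup>2 \<and> c2\<^sup>2 < c0 \<and> c1\<^sup>2 > 4 * c0 \<longrightarrow>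
      (\<exists>C0>0. \<exists>C1>0. \<forall>h1. real_analytic_on h1 {0..sqrt q0} \<longrightarrow>
        (\<exists>C>0. \<forall>(n::nat) \<mu> L f x0 xstar s.
          1 \<le> n \<longrightarrow> 0 < \<mu> \<longrightarrow> \<mu> \<le> L \<longrightarrow> f \<in> S1 n \<mu> L \<longrightarrow> x0 \<in> carrier_vec n \<longrightarrow>
          is_arg_min f (\<lambda>x. x \<in> carrier_vec n) xstar \<longrightarrow>
          0 < s \<longrightarrow> s \<le> C0 * \<mu> / L\<^sup>2 \<longrightarrow>
          \<mu> * s \<le> q0 \<and>
          (\<forall>k\<ge>1. f (iterates c0 c1 c2 R1 R2 R3 h1 n f \<mu> s x0 k) - f xstar
             \<le> C * L * (vnorm (x0 - xstar))\<^sup>2 * (1 - C1 * sqrt (\<mu> * s)) ^ k))))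
     \<and>
     (c2\<^sup>2 \<ge> c0 \<and> c1\<^sup>2 > 4 * c0 \<longrightarrow>
      (\<exists>C0>0. \<exists>C1>0. \<forall>h1. real_analytic_on h1 {0..sqrt q0} \<longrightarrow>
        (\<exists>C>0. \<forall>(n::nat) \<mu> L f x0 xstar s.
          1 \<le> n \<longrightarrow> 0 < \<mu> \<longrightarrow> \<mu> \<le> L \<longrightarrow> f \<in> S1 n \<mu> L \<longrightarrow> x0 \<in> carrier_vec n \<longrightarrow>
          is_arg_min f (\<lambda>x. x \<in> carrier_vec n) xstar \<longrightarrow>
          0 < s \<longrightarrow> s \<le> C0 / L \<longrightarrow>
          \<mu> * s \<le> q0 \<and>
          (\<forall>k\<ge>1. f (iterates c0 c1 c2 R1 R2 R3 h1 n f \<mu> s x0 k) - f xstar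
             \<le> C * L * (vnorm (x0 - xstar))\<^sup>2 * (1 - C1 * sqrt (\<mu> * s)) ^ k))))"
proof -
  obtain C0 \<theta> C1 where pos: "C0 > 0" "\<theta> > 0" "C1 > 0"
    and conv: "\<forall>h1. real_analytic_on h1 {0..sqrt q0} \<longrightarrow>
        (\<exists>C>0. \<forall>(n::nat) \<mu> L f x0 xstar s.
          0 < \<mu> \<longrightarrow> \<mu> \<le> L \<longrightarrow> f \<in> S1 n \<mu> L \<longrightarrow> x0 \<in> carrier_vec n \<longrightarrow>
          is_arg_min f (\<lambda>x. x \<in> carrier_vec n) xstar \<longrightarrow>
          0 < s \<longrightarrow> s * L \<le> C0 \<longrightarrow> s * L * (2 * sqrt c0 * (sqrt c0 - c2)) \<le> \<theta> * sqrt (\<mu> * s) \<longrightarrow>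
          \<mu> * s \<le> q0 \<and>
          (\<forall>k. f (iterates c0 c1 c2 R1 R2 R3 h1 n f \<mu> s x0 k) - f xstar
             \<le> C * L * (vnorm (x0 - xstar))\<^sup>2 * (1 - C1 * sqrt (\<mu> * s)) ^ k))"
    using accelerated_convergence[OF assms(1,2,4,8-10), of c2] by (elim exE conjE) (rule that)
  define P where "P = 2 * sqrt c0 * (sqrt c0 - c2)"
  \<comment> \<open>Chosen so that \<open>s * L\<^sup>2 \<le> \<epsilon> * \<mu>\<close>, multiplied
    by \<open>s\<close>, gives \<open>s * L * (\<bar>P\<bar> + 1) \<le> \<theta> * sqrt (\<mu> *
    s)\<close> after taking roots. The added 1 avoids division by zero.\<close>
  define \<epsilon> where "\<epsilon> = (\<theta> / (\<bar>P\<bar> + 1))\<^sup>2"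
  have \<epsilon>: "0 < \<epsilon>" using pos by (simp add: \<epsilon>_def add_nonneg_pos)
  have small_step: "s * L \<le> C0 \<and> s * L * P \<le> \<theta> * sqrt (\<mu> * s)"
    if mu: "0 < \<mu>" "\<mu> \<le> L" and s: "0 < s" "s \<le> min C0 \<epsilon> * \<mu> / L\<^sup>2" for \<mu> L s
  proof -
    have L: "0 < L" using mu by simp
    have sLL: "s * L\<^sup>2 \<le> min C0 \<epsilon> * \<mu>" using s L by (simp add: field_simps)
    have "s * L * L \<le> C0 * L"
    proof -
      have "min C0 \<epsilon> * \<mu> \<le> C0 * L" using mu pos \<epsilon> by (intro mult_mono) auto
      then show ?thesis using sLL by (simp add: power2_eq_square)
    qed
    then have 1: "s * L \<le> C0" using L by (rule mult_right_le_imp_le)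
    have "(s * L)\<^sup>2 = s * (s * L\<^sup>2)" by (simp add: power2_eq_square)
    also have "\<dots> \<le> s * (\<epsilon> * \<mu>)"
    proof (rule mult_left_mono)
      have "min C0 \<epsilon> * \<mu> \<le> \<epsilon> * \<mu>" using mu by (intro mult_right_mono) auto
      then show "s * L\<^sup>2 \<le> \<epsilon> * \<mu>" using sLL by simp
    qed (use s in simp)
    finally have "(s * L)\<^sup>2 \<le> (\<theta> / (\<bar>P\<bar> + 1) * sqrt (\<mu> * s))\<^sup>2"
      using mu s unfolding \<epsilon>_def power_mult_distrib by (simp add: mult_ac)
    then have "s * L \<le> \<theta> / (\<bar>P\<bar> + 1) * sqrt (\<mu> * s)"
      by (rule power2_le_imp_le) (use pos mu s in simp)
    then have "s * L * (\<bar>P\<bar> + 1) \<le> \<theta> * sqrt (\<mu> * s)"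
      by (simp add: field_simps add_pos_nonneg)
    moreover have "s * L * P \<le> s * L * (\<bar>P\<bar> + 1)"
      using s L by (intro mult_left_mono) auto
    ultimately show ?thesis using 1 by simp
  qed
  \<comment> \<open>Here \<open>sqrt c0 \<le> c2\<close> makes \<open>P\<close> nonpositive, so the
    second inequality holds by sign.\<close>
  have large_c2: "s * L \<le> C0 \<and> s * L * P \<le> \<theta> * sqrt (\<mu> * s)"
    if c2: "c2\<^sup>2 \<ge> c0" and mu: "0 < \<mu>" "\<mu> \<le> L" and s: "0 < s" "s \<le> C0 / L" for \<mu> L s
  proof -
    have L: "0 < L" using mu by simp
    have "sqrt c0 \<le> c2" using c2 assms(3) by (intro real_le_lsqrt) auto
    then have "P \<le> 0" using assms(1) by (simp add: P_def mult_nonneg_nonpos)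
    then have "s * L * P \<le> 0" using s L by (simp add: mult_nonneg_nonpos)
    also have "0 \<le> \<theta> * sqrt (\<mu> * s)" using pos mu s by simp
    finally show ?thesis using s L by (simp add: field_simps)
  qed
  \<comment> \<open>The predicate \<open>A\<close> stands for the stepsize restriction of either
    part.\<close>
  have wrap: "\<exists>C1>0. \<forall>h1. real_analytic_on h1 {0..sqrt q0} \<longrightarrow> (\<exists>C>0. \<forall>(n::nat) \<mu> L f x0 xstar s.
          1 \<le> n \<longrightarrow> 0 < \<mu> \<longrightarrow> \<mu> \<le> L \<longrightarrow> f \<in> S1 n \<mu> L \<longrightarrow> x0 \<in> carrier_vec n \<longrightarrow>
          is_arg_min f (\<lambda>x. x \<in> carrier_vec n) xstar \<longrightarrow>
          0 < s \<longrightarrow> A \<mu> L s \<longrightarrow>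
          \<mu> * s \<le> q0 \<and>
          (\<forall>k\<ge>1. f (iterates c0 c1 c2 R1 R2 R3 h1 n f \<mu> s x0 k) - f xstar
             \<le> C * L * (vnorm (x0 - xstar))\<^sup>2 * (1 - C1 * sqrt (\<mu> * s)) ^ k))"
    if A: "\<And>\<mu> L s. 0 < \<mu> \<Longrightarrow> \<mu> \<le> L \<Longrightarrow> 0 < s \<Longrightarrow> A \<mu> L s \<Longrightarrow>
      s * L \<le> C0 \<and> s * L * P \<le> \<theta> * sqrt (\<mu> * s)" for A :: "real \<Rightarrow> real \<Rightarrow> real \<Rightarrow> bool"
  proof (rule exI[of _ C1], intro conjI pos allI impI)
    fix h1 assume h1: "real_analytic_on h1 {0..sqrt q0}"
    obtain C where C: "C > 0" and bound: "\<forall>(n::nat) \<mu> L f x0 xstar s.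
          0 < \<mu> \<longrightarrow> \<mu> \<le> L \<longrightarrow> f \<in> S1 n \<mu> L \<longrightarrow> x0 \<in> carrier_vec n \<longrightarrow>
          is_arg_min f (\<lambda>x. x \<in> carrier_vec n) xstar \<longrightarrow>
          0 < s \<longrightarrow> s * L \<le> C0 \<longrightarrow> s * L * (2 * sqrt c0 * (sqrt c0 - c2)) \<le> \<theta> * sqrt (\<mu> * s) \<longrightarrow>
          \<mu> * s \<le> q0 \<and>
          (\<forall>k. f (iterates c0 c1 c2 R1 R2 R3 h1 n f \<mu> s x0 k) - f xstar
             \<le> C * L * (vnorm (x0 - xstar))\<^sup>2 * (1 - C1 * sqrt (\<mu> * s)) ^ k)"
      using conv[rule_format, OF h1] by (elim exE conjE) (rule that)
    show "\<exists>C>0. \<forall>(n::nat) \<mu> L f x0 xstar s.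
          1 \<le> n \<longrightarrow> 0 < \<mu> \<longrightarrow> \<mu> \<le> L \<longrightarrow> f \<in> S1 n \<mu> L \<longrightarrow> x0 \<in> carrier_vec n \<longrightarrow>
          is_arg_min f (\<lambda>x. x \<in> carrier_vec n) xstar \<longrightarrow>
          0 < s \<longrightarrow> A \<mu> L s \<longrightarrow>
          \<mu> * s \<le> q0 \<and>
          (\<forall>k\<ge>1. f (iterates c0 c1 c2 R1 R2 R3 h1 n f \<mu> s x0 k) - f xstar
             \<le> C * L * (vnorm (x0 - xstar))\<^sup>2 * (1 - C1 * sqrt (\<mu> * s)) ^ k)"
    proof (rule exI[of _ C], intro conjI[OF C] allI impI)
      fix n :: nat and \<mu> L s :: real and f and x0 xstar :: "real Matrix.vec"
      assume mu: "0 < \<mu>" "\<mu> \<le> L" and f: "f \<in> S1 n \<mu> L" "x0 \<in> carrier_vec n"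
        and min: "is_arg_min f (\<lambda>x. x \<in> carrier_vec n) xstar" and s: "0 < s" "A \<mu> L s"
      from A[OF mu s] bound[rule_format, OF mu f min s(1)]
      show "\<mu> * s \<le> q0 \<and> (\<forall>k\<ge>1. f (iterates c0 c1 c2 R1 R2 R3 h1 n f \<mu> s x0 k) - f xstar
             \<le> C * L * (vnorm (x0 - xstar))\<^sup>2 * (1 - C1 * sqrt (\<mu> * s)) ^ k)"
        by (simp add: P_def)
    qed
  qed
  show ?thesis
  proof (intro conjI impI)
    show "\<exists>C0>0. \<exists>C1>0. \<forall>h1. real_analytic_on h1 {0..sqrt q0} \<longrightarrow>
        (\<exists>C>0. \<forall>(n::nat) \<mu> L f x0 xstar s.
          1 \<le> n \<longrightarrow> 0 < \<mu> \<longrightarrow> \<mu> \<le> L \<longrightarrow> f \<in> S1 n \<mu> L \<longrightarrow> x0 \<in> carrier_vec n \<longrightarrow>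
          is_arg_min f (\<lambda>x. x \<in> carrier_vec n) xstar \<longrightarrow>
          0 < s \<longrightarrow> s \<le> C0 * \<mu> / L\<^sup>2 \<longrightarrow>
          \<mu> * s \<le> q0 \<and>
          (\<forall>k\<ge>1. f (iterates c0 c1 c2 R1 R2 R3 h1 n f \<mu> s x0 k) - f xstar
             \<le> C * L * (vnorm (x0 - xstar))\<^sup>2 * (1 - C1 * sqrt (\<mu> * s)) ^ k))"
      by (intro exI[of _ "min C0 \<epsilon>"] conjI wrap[of "\<lambda>\<mu> L s. s \<le> min C0 \<epsilon> * \<mu> / L\<^sup>2"] small_step)
        (use pos \<epsilon> in auto)
  next
    assume c2: "c2\<^sup>2 \<ge> c0 \<and> c1\<^sup>2 > 4 * c0"
    show "\<exists>C0>0. \<exists>C1>0. \<forall>h1. real_analytic_on h1 {0..sqrt q0} \<longrightarrow>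
        (\<exists>C>0. \<forall>(n::nat) \<mu> L f x0 xstar s.
          1 \<le> n \<longrightarrow> 0 < \<mu> \<longrightarrow> \<mu> \<le> L \<longrightarrow> f \<in> S1 n \<mu> L \<longrightarrow> x0 \<in> carrier_vec n \<longrightarrow>
          is_arg_min f (\<lambda>x. x \<in> carrier_vec n) xstar \<longrightarrow>
          0 < s \<longrightarrow> s \<le> C0 / L \<longrightarrow>
          \<mu> * s \<le> q0 \<and>
          (\<forall>k\<ge>1. f (iterates c0 c1 c2 R1 R2 R3 h1 n f \<mu> s x0 k) - f xstar
             \<le> C * L * (vnorm (x0 - xstar))\<^sup>2 * (1 - C1 * sqrt (\<mu> * s)) ^ k))"
      by (intro exI[of _ C0] conjI pos wrap[of "\<lambda>\<mu> L s. s \<le> C0 / L"] large_c2 c2[THEN conjunct1])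
  qed
qed

end
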